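(* Let $\{V_n^{(k)}\}_{k=1}^K$, $n\ge 0$, be the ensemble of an ensemble square root filter with adaptive inflation (ETKF-AI or EAKF-AI) as described in the context, run with any inflation strengths satisfying $\lambda_n\ge\varphi(\Theta_n,\Xi_n)$ for all $n\ge1$. Suppose the model satisfies an energy principle: there are constants $\beta_h\in(0,1)$, $K_h>0$ such that $$|\Psi_h(u)|^2+\mathrm{tr}(R_h(u))\le(1-\beta_h)|u|^2+K_h\quad\text{for all }u\in\mathbb{R}^d .$$ Let $\rho_0=\min_{1\le i\le q}h_i^2$ be the minimum eigenvalue of $H_0H_0^T$ and let $$\mathcal{E}_n=4K\rho_0^{-1}\beta_h^{-1}\|H\|^2|U_n|^2+\sum_{k=1}^K|V_n^{(k)}|^2 .$$ Then there exists a constant $D>0$ such that for all $n\ge1$ $$\mathbb{E}_{n-1}\mathcal{E}_n\le(1-\tfrac12\beta_h)\,\mathcal{E}_{n-1}+D .$$ In particular, if $\mathbb{E}\,\mathcal{E}_0<\infty$, then $\sup_{n\ge0}\mathbb{E}\,\mathcal{E}_n<\infty$.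
   Context: **Signal.** $U_n\in\mathbb{R}^d$ is generated by $U_n=\Psi_h(U_{n-1})+\zeta_n$, where $\Psi_h:\mathbb{R}^d\to\mathbb{R}^d$ is a deterministic (measurable) map. Conditionally on $U_{n-1}$, the noise $\zeta_n$ is independent of the past, has a conditional law depending only on $U_{n-1}$, conditional mean $0$ and conditional covariance $R_h(U_{n-1})=\mathbb{E}(\zeta_n\otimes\zeta_n\mid U_{n-1})$. **Observations.** $Z_n=HU_n+\xi_n\in\mathbb{R}^q$, where $1\le q\le d$, $H=(H_0,0_{q\times(d-q)})$, $H_0=\mathrm{diag}(h_1,\dots,h_q)$ with $h_i>0$ fixed, and $\xi_n\sim\mathcal N(0,I_q)$ are i.i.d. and independent of the signal noise and of the past. **ETKF-AI / EAKF-AI.** Fix the ensemble size $K\ge2$, and constants $c_\varphi>0$, $M_1>0$, $M_2>0$. Given the ensemble $\{V_{n-1}^{(k)}\}_{k=1}^K\subset\mathbb{R}^d$ at time $n-1$: - Forecast: $\widehat V_n^{(k)}=\Psi_h(V_{n-1}^{(k)})+\zeta_n^{(k)}$, where, conditionally on the past, the $\zeta_n^{(k)}$ are independent of each other and of $\zeta_n,\xi_n$, and $\zeta_n^{(k)}$ has the conditional law of $\zeta_n$ given $U_{n-1}=V_{n-1}^{(k)}$. - Forecast mean, spread and covariance: $\overline{\widehat V}_n=\frac1K\sum_{k}\widehat V_n^{(k)}$, $\widehat S_n=[\widehat V_n^{(1)}-\overline{\widehat V}_n,\dots,\widehat V_n^{(K)}-\overline{\widehat V}_n]\in\mathbb{R}^{d\times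 K}$, $\widehat C_n=\frac1{K-1}\widehat S_n\widehat S_n^T$. - Mean update with inflated covariance $\widetilde C_n=\widehat C_n+\lambda_nI_d$: $\overline V_n=\overline{\widehat V}_n-\widetilde C_nH^T(I+H\widetilde C_nH^T)^{-1}(H\overline{\widehat V}_n-Z_n)$. - Spread update (without inflation): $S_n\in\mathbb{R}^{d\times K}$ is obtained from $\widehat S_n$ by multiplication with a matrix, either on the left by a $d\times d$ matrix or on the right by a $K\times K$ matrix (the two options being the two filters), chosen so that $$\frac1{K-1}S_nS_n^T=C_n:=\widehat C_n-\widehat C_nH^T(I+H\widehat C_nH^T)^{-1}H\widehat C_n$$ and so that the columns of $S_n$ sum to zero. - Posterior ensemble: $V_n^{(k)}=\overline V_n+S_n^{(k)}$, with $S_n^{(k)}$ the $k$-th column of $S_n$ (so that $\overline V_n$ and $C_n$ are the posterior ensemble mean and covariance). **Inflation statistics.** Write $\widehat V_n^{(k)}=(\widehat X_n^{(k)},\widehat Y_n^{(k)})$ with $\widehat X_n^{(k)}\in\mathbb{R}^q$ the first $q$ coordinates and $\widehat Y_n^{(k)}\in\mathbb{R}^{d-q}$ the remaining ones, with ensemble means $\overline{\widehat X}_n,\overline{\widehat Y}_n$. Define $$\Theta_n=\Big(\frac1K\sum_{k=1}^K|H\widehat V_n^{(k)}-Z_n|^2\Big)^{1/2},\qquad \Xi_n=\Big\|\frac1{K-1}\sum_{k=1}^K(\widehat X_n^{(k)}-\overline{\widehat X}_n)\otimes(\widehat Y_n^{(k)}-\overline{\widehat Y}_n)\Big\|,$$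 $$\varphi(x,y)=c_\varphi\,x(1+y)\,\mathbf 1_{\{x>M_1\text{ or }y>M_2\}} .$$ The inflation strength $\lambda_n$ is a random variable measurable with respect to the $\sigma$-algebra generated by the initial data and all noises up to time $n$. **Notation.** $|\cdot|$ is the Euclidean norm, $\|\cdot\|$ the operator norm, $a\otimes b=ab^T$. $\mathbb{E}_{n}$ is conditional expectation given $\mathcal F_n=\sigma\{U_m,V_m^{(1)},\dots,V_m^{(K)}:m\le n\}$. *)

theory Defs
  imports "HOL-Probability.Probability"
begin

definition opnorm :: "real^'n^'m \<Rightarrow> real" where
  "opnorm A = onorm (\<lambda>x. A *v x)"

definition outer :: "real^'m \<Rightarrow> real^'n \<Rightarrow> real^'n^'m" where
  "outer a b = (\<chi> i j. a $ i * b $ j)"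

text \<open>
  The index type of the state space carries no order, so the ``first q coordinates'' are named by an
  injection \<open>\<iota>\<close> of the observation indices into the state indices; the remaining d - q coordinates are
  those outside \<open>range \<iota>\<close>.  The case q = d is allowed.
\<close>

definition obs_matrix :: "('q::finite \<Rightarrow> 'd::finite) \<Rightarrow> ('q \<Rightarrow> real) \<Rightarrow> real^'d^'q" where
  "obs_matrix \<iota> h = (\<chi> j i. if i = \<iota> j then h j else 0)"

definition obs_part :: "('q::finite \<Rightarrow> 'd::finite) \<Rightarrow> real^'d \<Rightarrow> real^'q" where
  "obs_part \<iota> v = (\<chi> j. v $ \<iota> j)"

text \<open>
  Since d - q is not available as an index type (and may be 0), the unobserved part is padded by
  zeros on the observed coordinates.  This changes no Euclidean norm, and the matrices formed
  from it only acquire zero columns, which changes no operator norm.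
\<close>

definition unobs_part :: "('q::finite \<Rightarrow> 'd::finite) \<Rightarrow> real^'d \<Rightarrow> real^'d" where
  "unobs_part \<iota> v = (\<chi> i. if i \<in> range \<iota> then 0 else v $ i)"

definition ens_mean :: "('k::finite \<Rightarrow> 'v::real_vector) \<Rightarrow> 'v" where
  "ens_mean v = (1 / real CARD('k)) *\<^sub>R (\<Sum>k\<in>UNIV. v k)"

definition ens_spread :: "('k::finite \<Rightarrow> real^'d) \<Rightarrow> real^'k^'d" where
  "ens_spread v = (\<chi> i k. (v k - ens_mean v) $ i)"

definition spread_cov :: "real^'k^'d \<Rightarrow> real^'d^'d" where
  "spread_cov S = (1 / (real CARD('k) - 1)) *\<^sub>R (S ** transpose S)"

definition ens_cov :: "('k::finite \<Rightarrow> real^'d) \<Rightarrow> real^'d^'d" where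
  "ens_cov v = spread_cov (ens_spread v)"

definition kalman_gain :: "real^'d^'q \<Rightarrow> real^'d^'d \<Rightarrow> real^'q^'d" where
  "kalman_gain H C = C ** transpose H ** matrix_inv (mat 1 + H ** C ** transpose H)"

definition kalman_mean :: "real^'d^'q \<Rightarrow> real^'d^'d \<Rightarrow> real^'d \<Rightarrow> real^'q \<Rightarrow> real^'d" where
  "kalman_mean H C m z = m - kalman_gain H C *v (H *v m - z)"

definition kalman_cov :: "real^'d^'q \<Rightarrow> real^'d^'d \<Rightarrow> real^'d^'d" where
  "kalman_cov H C = C - kalman_gain H C ** H ** C"

definition innovation_stat ::
    "real^'d^'q \<Rightarrow> ('k::finite \<Rightarrow> real^'d) \<Rightarrow> real^'q \<Rightarrow> real" where
  "innovation_stat H v z = sqrt ((1 / real CARD('k)) * (\<Sum>k\<in>UNIV. (norm (H *v v k - z))\<^sup>2))"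

definition cross_cov_stat :: "('q::finite \<Rightarrow> 'd::finite) \<Rightarrow> ('k::finite \<Rightarrow> real^'d) \<Rightarrow> real" where
  "cross_cov_stat \<iota> v = opnorm ((1 / (real CARD('k) - 1)) *\<^sub>R
     (\<Sum>k\<in>UNIV. outer (obs_part \<iota> (v k) - ens_mean (\<lambda>l. obs_part \<iota> (v l)))
                     (unobs_part \<iota> (v k) - ens_mean (\<lambda>l. unobs_part \<iota> (v l)))))"

definition inflation_fn :: "real \<Rightarrow> real \<Rightarrow> real \<Rightarrow> real \<Rightarrow> real \<Rightarrow> real" where
  "inflation_fn c M1 M2 x y = c * x * (1 + y) * of_bool (x > M1 \<or> y > M2)"

definition std_gaussian :: "(real^'q) measure" where
  "std_gaussian = density lborel (\<lambda>x. ennreal (\<Prod>j\<in>UNIV. std_normal_density (x $ j)))"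

definition second_moment :: "(real^'d) measure \<Rightarrow> real^'d^'d" where
  "second_moment \<mu> = (\<chi> i j. \<integral>z. z $ i * z $ j \<partial>\<mu>)"

definition preimages :: "'w measure \<Rightarrow> ('w \<Rightarrow> 'b::topological_space) \<Rightarrow> 'w set set" where
  "preimages M X = {X -` B \<inter> space M | B. B \<in> sets borel}"

text \<open>The filtration \<open>\<F>\<^sub>n\<close> generated by the signal and the ensemble.\<close>

definition state_algebra ::
    "'w measure \<Rightarrow> (nat \<Rightarrow> 'w \<Rightarrow> real^'d) \<Rightarrow> (nat \<Rightarrow> 'k \<Rightarrow> 'w \<Rightarrow> real^'d) \<Rightarrow> nat \<Rightarrow> 'w measure" where
  "state_algebra M U V n =
     sigma (space M) (\<Union>m\<in>{0..n}. preimages M (U m) \<union> (\<Union>k. preimages M (V m k)))"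

text \<open>
  The ``past'' up to time n: the initial data \<open>u0\<close>, \<open>v0\<close> and all noises (signal noise \<open>\<zeta>\<close>, ensemble
  noise \<open>\<eta>\<close>, observation noise \<open>\<xi>\<close>) at times 1 to n.
\<close>

definition noise_algebra ::
    "'w measure \<Rightarrow> ('w \<Rightarrow> real^'d) \<Rightarrow> ('k \<Rightarrow> 'w \<Rightarrow> real^'d) \<Rightarrow> (nat \<Rightarrow> 'w \<Rightarrow> real^'d) \<Rightarrow>
     (nat \<Rightarrow> 'k \<Rightarrow> 'w \<Rightarrow> real^'d) \<Rightarrow> (nat \<Rightarrow> 'w \<Rightarrow> real^'q) \<Rightarrow> nat \<Rightarrow> 'w measure" where
  "noise_algebra M u0 v0 \<zeta> \<eta> \<xi> n =
     sigma (space M)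
       (preimages M u0 \<union> (\<Union>k. preimages M (v0 k)) \<union>
        (\<Union>m\<in>{1..n}. preimages M (\<zeta> m) \<union> (\<Union>k. preimages M (\<eta> m k)) \<union> preimages M (\<xi> m)))"

text \<open>
  Given the \<open>\<sigma>\<close>-algebra G, the variables \<open>z\<close>, \<open>e k\<close> and \<open>x\<close> are independent, with conditional
  laws \<open>\<kappa> (u \<omega>)\<close>, \<open>\<kappa> (v k \<omega>)\<close> and the standard Gaussian law.  In particular \<open>x\<close> is independent of G
  and of the other variables, since its conditional law is not random.
\<close>

definition cond_noise_law ::
    "'w measure \<Rightarrow> 'w measure \<Rightarrow> (real^'d \<Rightarrow> (real^'d) measure) \<Rightarrow>
     ('w \<Rightarrow> real^'d) \<Rightarrow> ('k::finite \<Rightarrow> 'w \<Rightarrow> real^'d) \<Rightarrow>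
     ('w \<Rightarrow> real^'d) \<Rightarrow> ('k \<Rightarrow> 'w \<Rightarrow> real^'d) \<Rightarrow> ('w \<Rightarrow> real^'q) \<Rightarrow> bool" where
  "cond_noise_law M G \<kappa> u v z e x \<longleftrightarrow>
     (\<forall>A \<in> sets borel. \<forall>B. (\<forall>k. B k \<in> sets borel) \<longrightarrow> (\<forall>C \<in> sets borel.
        AE \<omega> in M.
          nn_cond_exp M G (indicator {\<omega> \<in> space M. z \<omega> \<in> A \<and> (\<forall>k. e k \<omega> \<in> B k) \<and> x \<omega> \<in> C}) \<omega>
          = emeasure (\<kappa> (u \<omega>)) A * (\<Prod>k\<in>UNIV. emeasure (\<kappa> (v k \<omega>)) (B k))
            * emeasure std_gaussian C))"

end

theory Submission
  imports Defs
begin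

text \<open>
  Let \<open>w = H m - z\<close> be the residual of the posterior mean \<open>m\<close>. It solves
  \<open>(1 + H C H\<^sup>T) w = r\<close> with the inflated covariance \<open>C\<close> and the innovation \<open>r\<close> of the forecast mean,
  so the inflation gives \<open>(1 + lam * \<rho>0) |w| \<le> |r| \<le> \<Theta>\<close>. The unobserved part of the mean moves by at
  most \<open>\<Xi> \<parallel>H\<parallel> |w|\<close>, because a multiple of the identity has no cross block. As the inflation is at least
  \<open>c \<Theta> (1 + \<Xi>)\<close> whenever \<open>\<Theta>\<close> or \<open>\<Xi>\<close> is large, \<open>(1 + \<Xi>) |w|\<close> is bounded by a deterministic constant.
  Hence, pathwise, the observed part of the mean is controlled by the observation, the unobserved part
  by its forecast, and the spread does not grow, since the covariance update decreases the trace.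
  Taking conditional expectations, the energy principle contracts the forecast, and the weight of the
  signal in the energy is large enough to absorb the contribution of the observation.
\<close>

subsection \<open>Pathwise energy bound for one assimilation step\<close>

text \<open>Parallel axis identity: the deviations from the mean sum to zero, so no cross term
  survives. It splits an ensemble energy into a mean part and a spread part, which the filter
  updates by different rules.\<close>

lemma sum_norm_sq_ens_mean:
  fixes v :: "'k::finite \<Rightarrow> 'v::real_inner"
  shows "(\<Sum>k\<in>UNIV. (norm (v k))\<^sup>2)
       = real CARD('k) * (norm (ens_mean v))\<^sup>2 + (\<Sum>k\<in>UNIV. (norm (v k - ens_mean v))\<^sup>2)"
proof -
  define m where "m = ens_mean v"
  have K: "real CARD('k) > 0" by simp
  have s: "(\<Sum>k\<in>UNIV. v k) = real CARD('k) *\<^sub>R m"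
    using K by (simp add: m_def ens_mean_def)
  have "(\<Sum>k\<in>UNIV. (norm (v k - m))\<^sup>2)
      = (\<Sum>k\<in>UNIV. (norm (v k))\<^sup>2 + (norm m)\<^sup>2 - 2 * (v k \<bullet> m))"
    by (intro sum.cong refl) (simp add: power2_norm_eq_inner inner_diff inner_commute)
  also have "\<dots> = (\<Sum>k\<in>UNIV. (norm (v k))\<^sup>2) + real CARD('k) * (norm m)\<^sup>2
      - 2 * ((\<Sum>k\<in>UNIV. v k) \<bullet> m)"
    by (simp add: sum.distrib sum_subtractf sum_distrib_left inner_sum_left)
  also have "\<dots> = (\<Sum>k\<in>UNIV. (norm (v k))\<^sup>2) - real CARD('k) * (norm m)\<^sup>2"
    unfolding s by (simp add: power2_norm_eq_inner)
  finally show ?thesis by (simp add: m_def)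
qed

lemma norm_ens_mean_sq_le:
  fixes v :: "'k::finite \<Rightarrow> 'v::real_inner"
  shows "(norm (ens_mean v))\<^sup>2 \<le> (1 / real CARD('k)) * (\<Sum>k\<in>UNIV. (norm (v k))\<^sup>2)"
  unfolding sum_norm_sq_ens_mean[of v] by (simp add: field_simps sum_nonneg)

lemma ens_mean_linear:
  assumes "linear f"
  shows "ens_mean (\<lambda>k. f (v k)) = f (ens_mean v)"
  using assms by (simp add: ens_mean_def linear_sum linear_cmul)

text \<open>Young's inequality, from expanding the square of
  \<open>sqrt e *\<^sub>R a - (1 / sqrt e) *\<^sub>R b\<close>. A small \<open>e\<close> keeps the
  factor of the leading term close to 1.\<close>

lemma norm_add_sq_le:
  fixes a b :: "'v::real_inner"
  assumes "e > 0"
  shows "(norm (a + b))\<^sup>2 \<le> (1 + e) * (norm a)\<^sup>2 + (1 + 1 / e) * (norm b)\<^sup>2"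
proof -
  have "(norm (sqrt e *\<^sub>R a - (1 / sqrt e) *\<^sub>R b))\<^sup>2
      = e * (norm a)\<^sup>2 + (1 / e) * (norm b)\<^sup>2 - 2 * (a \<bullet> b)"
    using assms unfolding power2_norm_eq_inner
    by (simp add: inner_diff inner_commute algebra_simps)
  then have "2 * (a \<bullet> b) \<le> e * (norm a)\<^sup>2 + (1 / e) * (norm b)\<^sup>2"
    by (smt (verit) zero_le_power2)
  moreover have "(norm (a + b))\<^sup>2 = (norm a)\<^sup>2 + (norm b)\<^sup>2 + 2 * (a \<bullet> b)"
    unfolding power2_norm_eq_inner by (simp add: inner_add inner_commute)
  ultimately show ?thesis by (simp add: algebra_simps)
qed

lemma inner_transpose_mult:
  fixes A :: "real^'n^'m"
  shows "(transpose A *v w) \<bullet> x = w \<bullet> (A *v x)"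
  by (metis dot_lmul_matrix transpose_matrix_vector)

lemma norm_mult_le_opnorm: "norm (A *v x) \<le> opnorm A * norm x"
  unfolding opnorm_def by (rule onorm[OF matrix_vector_mul_bounded_linear])

lemma opnorm_nonneg: "0 \<le> opnorm A"
  unfolding opnorm_def by (rule onorm_pos_le[OF matrix_vector_mul_bounded_linear])

text \<open>Duality: with \<open>?u\<close> as its own test vector, the matrix moves to the other
  side of the inner product and one factor \<open>norm ?u\<close> cancels.\<close>

lemma norm_transpose_mult_le_opnorm: "norm (transpose A *v w) \<le> opnorm A * norm w"
proof -
  let ?u = "transpose A *v w"
  have "norm ?u * norm ?u = w \<bullet> (A *v ?u)"
    by (metis inner_transpose_mult norm_eq_sqrt_inner real_sqrt_mult_self abs_of_nonneg inner_ge_zero)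
  also have "\<dots> \<le> norm w * (opnorm A * norm ?u)"
    by (rule order_trans[OF norm_cauchy_schwarz mult_left_mono[OF norm_mult_le_opnorm]]) simp
  finally have "norm ?u * norm ?u \<le> (opnorm A * norm w) * norm ?u"
    by (simp add: mult_ac)
  then show ?thesis
    by (cases "norm ?u = 0") (auto simp: opnorm_nonneg)
qed

section \<open>Ensemble covariances as sums of rank-one maps\<close>

lemma spread_cov_mult:
  fixes S :: "real^'k^'d"
  shows "spread_cov S *v x
       = (1 / (real CARD('k) - 1)) *\<^sub>R (\<Sum>k\<in>UNIV. (column k S \<bullet> x) *\<^sub>R column k S)"
proof -
  have "S ** transpose S *v x = (\<Sum>k\<in>UNIV. (column k S \<bullet> x) *\<^sub>R column k S)"
    by (simp add: vec_eq_iff matrix_matrix_mult_def matrix_vector_mult_def transpose_def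
        column_def inner_vec_def sum_distrib_right sum_distrib_left)
       (subst sum.swap, simp add: mult_ac)
  then show ?thesis
    by (simp add: spread_cov_def scaleR_matrix_vector_assoc[symmetric] del: transpose_matrix_vector)
qed

lemma column_ens_spread: "column k (ens_spread v) = v k - ens_mean v"
  by (simp add: column_def ens_spread_def vec_eq_iff)

lemma spread_cov_nonneg:
  fixes S :: "real^'k^'d"
  shows "x \<bullet> (spread_cov S *v x) \<ge> 0"
  unfolding spread_cov_mult
  by (auto simp: inner_sum_right inner_commute intro!: divide_nonneg_nonneg sum_nonneg)

lemma transpose_spread_cov: "transpose (spread_cov S) = spread_cov S"
  by (simp add: spread_cov_def transpose_scalar matrix_transpose_mul)

text \<open>Both sides sum the squared entries of \<open>S\<close>. This turns a comparison of
  covariance traces into one of ensemble spreads; with at least two members the factor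
  \<open>1 / (real CARD('k) - 1)\<close> can be cancelled.\<close>

lemma trace_spread_cov:
  fixes S :: "real^'k^'d"
  assumes "CARD('k) \<ge> 2"
  shows "(real CARD('k) - 1) * trace (spread_cov S) = (\<Sum>k\<in>UNIV. (norm (column k S))\<^sup>2)"
proof -
  have "trace (S ** transpose S) = (\<Sum>k\<in>UNIV. (norm (column k S))\<^sup>2)"
    unfolding power2_norm_eq_inner
    by (simp add: trace_def matrix_matrix_mult_def transpose_def column_def inner_vec_def)
       (rule sum.swap)
  moreover have "trace (spread_cov S) = (1 / (real CARD('k) - 1)) * trace (S ** transpose S)"
    by (simp add: spread_cov_def trace_def sum_distrib_left)
  ultimately show ?thesis using assms by simp
qed

section \<open>Innovation covariance and Kalman update\<close>

lemma innovation_cov_mult: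
  fixes H :: "real^'d^'q" and C :: "real^'d^'d"
  shows "(mat 1 + H ** C ** transpose H) *v w = w + H *v (C *v (transpose H *v w))"
  by (simp add: matrix_vector_mult_add_rdistrib matrix_vector_mul_assoc matrix_mul_assoc
      del: transpose_matrix_vector)

text \<open>Serves twice: the first summand makes the innovation covariance invertible, and the
  second one, for an inflated \<open>C\<close>, damps the residual.\<close>

lemma inner_innovation_cov:
  fixes H :: "real^'d^'q" and C :: "real^'d^'d"
  shows "w \<bullet> ((mat 1 + H ** C ** transpose H) *v w)
       = (norm w)\<^sup>2 + (transpose H *v w) \<bullet> (C *v (transpose H *v w))"
  unfolding innovation_cov_mult
  by (simp add: inner_add_right power2_norm_eq_inner inner_transpose_mult del: transpose_matrix_vector)

text \<open>The quadratic form dominates \<open>(norm w)\<^sup>2\<close>, so the kernel is trivial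
  and the matrix is invertible.\<close>

lemma innovation_cov_inverse:
  fixes H :: "real^'d^'q" and C :: "real^'d^'d"
  assumes "\<And>x. x \<bullet> (C *v x) \<ge> 0"
  shows "(mat 1 + H ** C ** transpose H) ** matrix_inv (mat 1 + H ** C ** transpose H) = mat 1"
proof -
  let ?A = "mat 1 + H ** C ** transpose H"
  have "w = 0" if "?A *v w = 0" for w
  proof -
    have "(norm w)\<^sup>2 + (transpose H *v w) \<bullet> (C *v (transpose H *v w)) = 0"
      unfolding inner_innovation_cov[symmetric] that by simp
    with assms[of "transpose H *v w"] have "(norm w)\<^sup>2 \<le> 0" by linarith
    then show ?thesis by simp
  qed
  then have "invertible ?A"
    unfolding invertible_left_inverse matrix_left_invertible_ker by blast
  then have "\<exists>B. ?A ** B = mat 1 \<and> B ** ?A = mat 1"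
    unfolding invertible_def .
  then show ?thesis
    unfolding matrix_inv_def by (rule someI_ex[THEN conjunct1])
qed

text \<open>Each diagonal entry of the subtracted matrix is a value of the quadratic form of the
  innovation covariance \<open>?A\<close>, at
  \<open>y = matrix_inv ?A *v (H *v (C *v axis i 1))\<close>, hence nonnegative.\<close>

lemma trace_kalman_cov_le:
  fixes H :: "real^'d^'q" and C :: "real^'d^'d"
  assumes psd: "\<And>x. x \<bullet> (C *v x) \<ge> 0" and sym: "transpose C = C"
  shows "trace (kalman_cov H C) \<le> trace C"
proof -
  let ?A = "mat 1 + H ** C ** transpose H"
  let ?B = "kalman_gain H C ** H ** C"
  have "?B $ i $ i \<ge> 0" for i
  proof -
    define x where "x = H *v (C *v axis i 1)"
    define y where "y = matrix_inv ?A *v x"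
    have x: "x = ?A *v y"
      by (simp add: y_def matrix_vector_mul_assoc innovation_cov_inverse[OF psd])
    have "?B $ i $ i = axis i 1 \<bullet> (?B *v axis i 1)"
      by (simp add: inner_axis' matrix_vector_mul_component inner_axis)
    also have "\<dots> = axis i 1 \<bullet> (C *v (transpose H *v y))"
      by (simp add: kalman_gain_def y_def x_def matrix_vector_mul_assoc matrix_mul_assoc)
    \<comment> \<open>Symmetry of \<open>C\<close> carries it over to the basis vector, which
      reproduces \<open>x\<close>.\<close>
    also have "\<dots> = x \<bullet> y"
      by (metis inner_commute inner_transpose_mult sym x_def)
    also have "\<dots> = y \<bullet> (?A *v y)"
      by (metis x inner_commute)
    also have "\<dots> \<ge> 0"
      unfolding inner_innovation_cov using psd by simp
    finally show ?thesis .
  qed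
  then show ?thesis
    by (simp add: kalman_cov_def trace_def sum_mono)
qed

text \<open>The gain equation in implicit form: applying \<open>H\<close> to the update subtracts
  \<open>A *v ?w - ?w\<close> from the innovation \<open>A *v ?w\<close>, and what is left is
  \<open>?w\<close> itself. So the residual of the updated mean is the vector that drives the
  update.\<close>

lemma kalman_mean_residual:
  fixes H :: "real^'d^'q" and C :: "real^'d^'d"
  assumes "\<And>x. x \<bullet> (C *v x) \<ge> 0"
    and A_def: "A = mat 1 + H ** C ** transpose H"
    and w_def: "w = H *v kalman_mean H C m z - z"
  shows "kalman_mean H C m z = m - C *v (transpose H *v w)" and "A *v w = H *v m - z"
proof -
  let ?w = "matrix_inv A *v (H *v m - z)"
  have A: "A *v ?w = H *v m - z"
    using innovation_cov_inverse[OF assms(1), of H]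
    by (simp add: A_def matrix_vector_mul_assoc)
  have k: "kalman_mean H C m z = m - C *v (transpose H *v ?w)"
    by (simp add: kalman_mean_def kalman_gain_def A_def matrix_vector_mul_assoc matrix_mul_assoc)
  have "H *v (C *v (transpose H *v ?w)) = A *v ?w - ?w"
    unfolding A_def innovation_cov_mult by simp
  then have "w = ?w"
    unfolding w_def k matrix_vector_mult_diff_distrib[of H m] A by simp
  then show "kalman_mean H C m z = m - C *v (transpose H *v w)" "A *v w = H *v m - z"
    using k A by (simp_all only:)
qed

section \<open>Observation matrix and splitting into observed and unobserved coordinates\<close>

lemma obs_matrix_mult: "obs_matrix \<iota> h *v x = (\<chi> j. h j * x $ \<iota> j)"
  by (simp add: vec_eq_iff obs_matrix_def matrix_vector_mult_def if_distrib[of "\<lambda>t. t * _"] cong: if_cong)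

lemma norm_obs_unobs:
  assumes "inj \<iota>"
  shows "(norm v)\<^sup>2 = (norm (obs_part \<iota> v))\<^sup>2 + (norm (unobs_part \<iota> v))\<^sup>2"
proof -
  have "(norm v)\<^sup>2 = (\<Sum>i\<in>range \<iota>. v $ i * v $ i) + (\<Sum>i\<in>-range \<iota>. v $ i * v $ i)"
    unfolding power2_norm_eq_inner inner_vec_def
    by (subst sum.union_disjoint[symmetric]) auto
  also have "(\<Sum>i\<in>range \<iota>. v $ i * v $ i) = (norm (obs_part \<iota> v))\<^sup>2"
    using assms by (simp add: power2_norm_eq_inner inner_vec_def obs_part_def sum.reindex)
  also have "(\<Sum>i\<in>-range \<iota>. v $ i * v $ i) = (norm (unobs_part \<iota> v))\<^sup>2"
    unfolding power2_norm_eq_inner inner_vec_def unobs_part_def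
    by (rule sum.mono_neutral_cong_left) auto
  finally show ?thesis .
qed

text \<open>Lets the observation control the observed coordinates of the state.\<close>

lemma norm_obs_matrix_mult_ge:
  assumes "\<And>j. r \<le> (h j)\<^sup>2"
  shows "r * (norm (obs_part \<iota> x))\<^sup>2 \<le> (norm (obs_matrix \<iota> h *v x))\<^sup>2"
proof -
  have "r * (x $ \<iota> j)\<^sup>2 \<le> (h j * x $ \<iota> j)\<^sup>2" for j
    by (simp add: power_mult_distrib mult_right_mono assms)
  then show ?thesis
    unfolding power2_norm_eq_inner obs_matrix_mult obs_part_def
    by (simp add: inner_vec_def sum_distrib_left power2_eq_square sum_mono)
qed

lemma transpose_obs_matrix_mult_outside:
  assumes "i \<notin> range \<iota>"
  shows "(transpose (obs_matrix \<iota> h) *v w) $ i = 0"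
  using assms by (auto simp: matrix_vector_mult_def transpose_def obs_matrix_def intro!: sum.neutral)

lemma transpose_obs_matrix_mult_at:
  assumes "inj \<iota>"
  shows "(transpose (obs_matrix \<iota> h) *v w) $ \<iota> j = h j * w $ j"
  using assms
  by (simp add: matrix_vector_mult_def transpose_def obs_matrix_def inj_eq
      if_distrib[of "\<lambda>t. t * _"] cong: if_cong)

text \<open>Coercivity of \<open>H H^T\<close>, which is diagonal with entries
  \<open>(h j)\<^sup>2\<close>. Through it a multiple of the identity added to the covariance acts
  on every component of the residual.\<close>

lemma norm_transpose_obs_matrix_mult_ge:
  assumes "inj \<iota>" "\<And>j. r \<le> (h j)\<^sup>2"
  shows "r * (norm w)\<^sup>2 \<le> (norm (transpose (obs_matrix \<iota> h) *v w))\<^sup>2"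
proof -
  let ?u = "transpose (obs_matrix \<iota> h) *v w"
  have "r * (w $ j)\<^sup>2 \<le> (?u $ \<iota> j)\<^sup>2" for j
    unfolding transpose_obs_matrix_mult_at[OF assms(1)]
    by (simp add: power_mult_distrib mult_right_mono assms(2))
  then have "r * (norm w)\<^sup>2 \<le> (norm (obs_part \<iota> ?u))\<^sup>2"
    unfolding power2_norm_eq_inner obs_part_def
    by (simp add: inner_vec_def sum_distrib_left power2_eq_square sum_mono)
  also have "\<dots> \<le> (norm ?u)\<^sup>2"
    using norm_obs_unobs[OF assms(1), of ?u] by simp
  finally show ?thesis .
qed

lemma linear_obs_part: "linear (obs_part \<iota>)"
  by (rule linearI) (simp_all add: obs_part_def vec_eq_iff)

lemma linear_unobs_part: "linear (unobs_part \<iota>)"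
  by (rule linearI) (simp_all add: unobs_part_def vec_eq_iff)

lemma outer_mult: "outer a b *v y = (b \<bullet> y) *\<^sub>R a"
  by (simp add: outer_def matrix_vector_mult_def vec_eq_iff inner_vec_def sum_distrib_left sum_distrib_right mult_ac)

lemma sum_matrix_vector_mult:
  fixes f :: "'a \<Rightarrow> real^'n^'m"
  shows "(\<Sum>k\<in>I. f k) *v x = (\<Sum>k\<in>I. f k *v x)"
  by (induction I rule: infinite_finite_induct) (simp_all add: matrix_vector_mult_add_rdistrib)

lemma cross_cov_stat_nonneg: "0 \<le> cross_cov_stat \<iota> v"
  by (simp add: cross_cov_stat_def opnorm_nonneg)

text \<open>Observing only the coordinates \<open>\<iota> j\<close>, the unobserved part of the covariance applied to a vector
  in the range of \<open>transpose H\<close> sees only the cross covariance block.\<close>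

lemma norm_unobs_ens_cov_le:
  fixes v :: "'k::finite \<Rightarrow> real^'d::finite" and \<iota> :: "'q::finite \<Rightarrow> 'd"
  assumes "inj \<iota>" and u_def: "u = transpose (obs_matrix \<iota> h) *v w"
  shows "norm (unobs_part \<iota> (ens_cov v *v u)) \<le> cross_cov_stat \<iota> v * norm u"
proof -
  define s where "s k = v k - ens_mean v" for k
  define y where "y = unobs_part \<iota> (ens_cov v *v u)"
  define B where "B = (1 / (real CARD('k) - 1)) *\<^sub>R
     (\<Sum>k\<in>UNIV. outer (obs_part \<iota> (s k)) (unobs_part \<iota> (s k)))"
  have Xi: "cross_cov_stat \<iota> v = opnorm B"
    unfolding cross_cov_stat_def B_def s_def
    by (simp add: ens_mean_linear[OF linear_obs_part] ens_mean_linear[OF linear_unobs_part]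
        linear_diff[OF linear_obs_part] linear_diff[OF linear_unobs_part])
  have By: "B *v y = (1 / (real CARD('k) - 1)) *\<^sub>R
      (\<Sum>k\<in>UNIV. (unobs_part \<iota> (s k) \<bullet> y) *\<^sub>R obs_part \<iota> (s k))"
    unfolding B_def scaleR_matrix_vector_assoc[symmetric] sum_matrix_vector_mult outer_mult ..
  \<comment> \<open>\<open>u\<close> vanishes off \<open>range \<iota>\<close>, so pairing a
    deviation with it only sees observed coordinates.\<close>
  have su: "obs_part \<iota> (s k) \<bullet> obs_part \<iota> u = s k \<bullet> u" for k
  proof -
    have "s k \<bullet> u = (\<Sum>i\<in>range \<iota>. s k $ i * u $ i)"
      unfolding inner_vec_def
      by (rule sum.mono_neutral_cong_right) (auto simp: u_def transpose_obs_matrix_mult_outside simp del: transpose_matrix_vector)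
    then show ?thesis
      using assms(1) by (simp add: inner_vec_def obs_part_def sum.reindex)
  qed
  have "unobs_part \<iota> (ens_cov v *v u)
      = (1 / (real CARD('k) - 1)) *\<^sub>R (\<Sum>k\<in>UNIV. (s k \<bullet> u) *\<^sub>R unobs_part \<iota> (s k))"
    unfolding ens_cov_def spread_cov_mult column_ens_spread s_def[symmetric]
    by (simp add: linear_cmul[OF linear_unobs_part] linear_sum[OF linear_unobs_part])
  \<comment> \<open>The left vector is the transposed cross covariance applied to the observed part
    of \<open>u\<close>; testing it with itself brings in \<open>B\<close>, whose norm is the
    statistic.\<close>
  then have "y \<bullet> y = y \<bullet> \<dots>" unfolding y_def by (rule arg_cong)
  also have "\<dots> = (B *v y) \<bullet> obs_part \<iota> u"
    unfolding By by (simp add: inner_sum_right inner_sum_left su inner_commute[of y] mult.commute)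
  also have "\<dots> \<le> norm (B *v y) * norm (obs_part \<iota> u)"
    by (rule norm_cauchy_schwarz)
  also have "\<dots> \<le> (opnorm B * norm y) * norm u"
  proof (intro mult_mono norm_mult_le_opnorm)
    show "norm (obs_part \<iota> u) \<le> norm u"
      by (rule power2_le_imp_le) (use norm_obs_unobs[OF assms(1), of u] in simp_all)
  qed (simp_all add: opnorm_nonneg)
  finally have "norm y * norm y \<le> (opnorm B * norm u) * norm y"
    by (simp add: power2_norm_eq_inner[symmetric] power2_eq_square mult_ac)
  then have "norm y \<le> opnorm B * norm u"
    by (cases "norm y = 0") (auto simp: opnorm_nonneg)
  then show ?thesis by (simp add: y_def Xi)
qed

text \<open>Jensen's inequality: the innovation of the mean is the mean of the member innovations,
  and \<open>innovation_stat\<close> is their root mean square.\<close>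

lemma innovation_stat_mean: "norm (H *v ens_mean v - z) \<le> innovation_stat H v z"
proof -
  have "ens_mean (\<lambda>k. H *v v k - z) = H *v ens_mean v - z"
    using ens_mean_linear[OF matrix_vector_mul_linear, of H v]
    by (simp add: ens_mean_def sum_subtractf scaleR_diff_right sum_constant_scaleR del: sum_constant)
  then show ?thesis
    unfolding innovation_stat_def
    using norm_ens_mean_sq_le[of "\<lambda>k. H *v v k - z"] by (intro real_le_rsqrt) simp
qed

text \<open>The inflation damps the residual by the factor \<open>1 / (1 + lam * r)\<close>, and it is triggered
  precisely when the statistics are not already bounded by \<open>M1\<close> and \<open>M2\<close>.\<close>

lemma inflated_residual_bound:
  fixes v :: "'k::finite \<Rightarrow> real^'d::finite" and \<iota> :: "'q::finite \<Rightarrow> 'd"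
  assumes inj: "inj \<iota>" and H: "H = obs_matrix \<iota> h"
    and r: "r > 0" "\<And>j. r \<le> (h j)\<^sup>2" and c: "c > 0" and M: "M1 > 0" "M2 > 0"
    and lam: "lam \<ge> inflation_fn c M1 M2 (innovation_stat H v z) (cross_cov_stat \<iota> v)"
    and w_def: "w = H *v kalman_mean H (ens_cov v + lam *\<^sub>R mat 1) (ens_mean v) z - z"
  shows "(1 + cross_cov_stat \<iota> v) * norm w \<le> 1 / (c * r) + M1 * (1 + M2)"
    and "lam \<ge> 0"
proof -
  define \<Theta> where "\<Theta> = innovation_stat H v z"
  define X where "X = cross_cov_stat \<iota> v"
  define u where "u = transpose H *v w"
  have \<Theta>: "\<Theta> \<ge> 0" using innovation_stat_mean[of H v z] norm_ge_zero unfolding \<Theta>_def by (rule order_trans[rotated])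
  have X: "X \<ge> 0" by (simp add: X_def cross_cov_stat_nonneg)
  have "inflation_fn c M1 M2 \<Theta> X \<ge> 0"
    using \<Theta> X c by (simp add: inflation_fn_def)
  with lam show lam0: "lam \<ge> 0" by (simp add: \<Theta>_def X_def)
  have mult: "(ens_cov v + lam *\<^sub>R mat 1) *v x = ens_cov v *v x + lam *\<^sub>R x" for x
    by (simp add: matrix_vector_mult_add_rdistrib scaleR_matrix_vector_assoc[symmetric])
  have cov: "x \<bullet> (ens_cov v *v x) \<ge> 0" for x
    by (simp add: ens_cov_def spread_cov_nonneg)
  have psd: "x \<bullet> ((ens_cov v + lam *\<^sub>R mat 1) *v x) \<ge> 0" for x
    using cov[of x] lam0 by (simp add: mult inner_add_right)
  note res = kalman_mean_residual[OF psd refl w_def]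
  \<comment> \<open>The equation for the residual is paired with \<open>w\<close>. Of the quadratic
    form only the inflation part is kept, bounded below by coercivity of
    \<open>transpose H\<close>.\<close>
  have "(1 + lam * r) * (norm w)\<^sup>2 \<le> (norm w)\<^sup>2 + lam * (norm u)\<^sup>2"
    using mult_left_mono[OF norm_transpose_obs_matrix_mult_ge[OF inj r(2), where w = w] lam0]
    by (simp add: u_def H algebra_simps)
  also have "\<dots> \<le> (norm w)\<^sup>2 + u \<bullet> ((ens_cov v + lam *\<^sub>R mat 1) *v u)"
    using cov[of u] by (simp add: mult inner_add_right power2_norm_eq_inner)
  also have "\<dots> = w \<bullet> (H *v ens_mean v - z)"
    unfolding res(2)[symmetric] inner_innovation_cov u_def ..
  also have "\<dots> \<le> norm w * \<Theta>"
    unfolding \<Theta>_def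
    by (rule order_trans[OF norm_cauchy_schwarz mult_left_mono[OF innovation_stat_mean]]) simp
  finally have "(1 + lam * r) * norm w * norm w \<le> \<Theta> * norm w"
    by (simp add: power2_eq_square mult_ac)
  then have damp: "(1 + lam * r) * norm w \<le> \<Theta>"
    using \<Theta> by (cases "norm w = 0") auto
  show "(1 + cross_cov_stat \<iota> v) * norm w \<le> 1 / (c * r) + M1 * (1 + M2)"
  proof (cases "\<Theta> > M1 \<or> X > M2")
    case True
    \<comment> \<open>With \<open>t\<close> the triggered inflation is at least
      \<open>c * t\<close>, so \<open>(1 + X) * norm w\<close> is at most
      \<open>t / (1 + c * t * r)\<close>, which stays below \<open>1 / (c * r)\<close> however large
      \<open>t\<close> is.\<close>
    define t where "t = \<Theta> * (1 + X)"
    have "c * t \<le> lam"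
      using lam True unfolding inflation_fn_def \<Theta>_def X_def t_def by (simp add: mult.assoc)
    then have "(1 + c * t * r) * norm w \<le> (1 + lam * r) * norm w"
      using r by (intro mult_right_mono) auto
    then have "(1 + c * t * r) * norm w * (1 + X) \<le> t"
      unfolding t_def using damp X by (intro mult_right_mono) auto
    moreover have "(1 + c * t * r) * (1 / (c * r)) = 1 / (c * r) + t"
      using c r by (simp add: field_simps)
    moreover have "1 / (c * r) > 0" using c r by simp
    ultimately have "(1 + c * t * r) * ((1 + X) * norm w) \<le> (1 + c * t * r) * (1 / (c * r))"
      by (simp only: mult_ac)
    moreover have "1 + c * t * r > 0"
      unfolding t_def using c r \<Theta> X by (intro add_pos_nonneg mult_nonneg_nonneg) auto
    ultimately have "(1 + X) * norm w \<le> 1 / (c * r)"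
      by (simp only: mult_le_cancel_left_pos)
    moreover have "M1 * (1 + M2) > 0" using M by simp
    ultimately show ?thesis unfolding X_def by linarith
  next
    case False
    \<comment> \<open>Here \<open>lam\<close> may vanish, but then both statistics are below their
      thresholds and nonnegativity of \<open>lam\<close> suffices.\<close>
    have "norm w \<le> (1 + lam * r) * norm w"
      using lam0 r by (simp add: distrib_right)
    with damp False have "norm w \<le> M1" by simp
    then have "(1 + X) * norm w \<le> (1 + M2) * M1"
      using False X by (intro mult_mono) auto
    moreover have "1 / (c * r) > 0" using c r by simp
    ultimately have "(1 + X) * norm w \<le> 1 / (c * r) + (1 + M2) * M1" by linarith
    then show ?thesis by (simp only: X_def mult.commute[of M1])
  qed
qed

text \<open>The posterior energy splits into mean and spread. The observed part of \<open>m\<close>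
  follows from \<open>H *v m = z + w\<close>, the unobserved part from its forecast plus a shift of
  size at most \<open>opnorm H * D\<close>, and the spread from the trace comparison. The Young
  parameter \<open>e\<close> stays free, to be matched later with the contraction of the
  model.\<close>

lemma analysis_energy_le:
  fixes v :: "'k::finite \<Rightarrow> real^'d::finite" and \<iota> :: "'q::finite \<Rightarrow> 'd" and S :: "real^'k^'d"
  assumes inj: "inj \<iota>" and H: "H = obs_matrix \<iota> h"
    and r: "r > 0" "\<And>j. r \<le> (h j)\<^sup>2" and c: "c > 0" and M: "M1 > 0" "M2 > 0" and e: "e > 0"
    and K: "CARD('k) \<ge> 2"
    and lam: "lam \<ge> inflation_fn c M1 M2 (innovation_stat H v z) (cross_cov_stat \<iota> v)"
    and m_def: "m = kalman_mean H (ens_cov v + lam *\<^sub>R mat 1) (ens_mean v) z"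
    and S_cov: "spread_cov S = kalman_cov H (ens_cov v)"
    and S_sum: "(\<Sum>k\<in>UNIV. column k S) = 0"
    and D_def: "D = 1 / (c * r) + M1 * (1 + M2)"
  shows "(\<Sum>k\<in>UNIV. (norm (m + column k S))\<^sup>2)
       \<le> 2 * real CARD('k) / r * (norm z)\<^sup>2 + (1 + e) * (\<Sum>k\<in>UNIV. (norm (v k))\<^sup>2)
         + real CARD('k) * (2 / r * D\<^sup>2 + (1 + 1 / e) * (opnorm H * D)\<^sup>2)"
proof -
  let ?K = "real CARD('k)"
  define w where "w = H *v m - z"
  define u where "u = transpose H *v w"
  define X where "X = cross_cov_stat \<iota> v"
  have Kp: "?K > 0" by simp
  have X: "X \<ge> 0" by (simp add: X_def cross_cov_stat_nonneg)
  have res: "(1 + X) * norm w \<le> D" and lam0: "lam \<ge> 0"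
    using inflated_residual_bound[OF inj H r c M lam, of w] unfolding w_def m_def X_def D_def by auto
  have D: "D > 0" unfolding D_def using c r M by (simp add: add_pos_pos)
  have cov: "x \<bullet> (ens_cov v *v x) \<ge> 0" for x
    by (simp add: ens_cov_def spread_cov_nonneg)
  have mult: "(ens_cov v + lam *\<^sub>R mat 1) *v x = ens_cov v *v x + lam *\<^sub>R x" for x
    by (simp add: matrix_vector_mult_add_rdistrib scaleR_matrix_vector_assoc[symmetric])
  have psd: "x \<bullet> ((ens_cov v + lam *\<^sub>R mat 1) *v x) \<ge> 0" for x
    using cov[of x] lam0 by (simp add: mult inner_add_right)
  have m: "m = ens_mean v - (ens_cov v *v u + lam *\<^sub>R u)"
    using kalman_mean_residual(1)[OF psd refl w_def[unfolded m_def]]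
    unfolding m_def u_def mult .
  have "norm w \<le> (1 + X) * norm w"
    using X by (simp add: algebra_simps)
  with res have wD: "norm w \<le> D" by simp
  have "r * (norm (obs_part \<iota> m))\<^sup>2 \<le> (norm (H *v m))\<^sup>2"
    unfolding H by (rule norm_obs_matrix_mult_ge[OF r(2)])
  also have "\<dots> = (norm (z + w))\<^sup>2" by (simp add: w_def)
  also have "\<dots> \<le> 2 * (norm z)\<^sup>2 + 2 * (norm w)\<^sup>2"
    using norm_add_sq_le[of 1 z w] by simp
  also have "\<dots> \<le> 2 * (norm z)\<^sup>2 + 2 * D\<^sup>2"
    using wD by (simp add: power_mono)
  finally have obs: "(norm (obs_part \<iota> m))\<^sup>2 \<le> 2 / r * (norm z)\<^sup>2 + 2 / r * D\<^sup>2"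
    using r by (simp add: field_simps)
  \<comment> \<open>\<open>u\<close> lies in the range of \<open>transpose H\<close>, so the term
    \<open>lam *\<^sub>R u\<close> of the update moves no unobserved coordinate, however large
    \<open>lam\<close> is.\<close>
  have u0: "unobs_part \<iota> u = 0"
    by (simp add: vec_eq_iff unobs_part_def u_def H transpose_obs_matrix_mult_outside del: transpose_matrix_vector)
  have um: "unobs_part \<iota> m = unobs_part \<iota> (ens_mean v) + - unobs_part \<iota> (ens_cov v *v u)"
    by (simp add: m linear_diff[OF linear_unobs_part] linear_add[OF linear_unobs_part]
        linear_cmul[OF linear_unobs_part] u0)
  have "norm (unobs_part \<iota> (ens_cov v *v u)) \<le> X * norm u"
    unfolding X_def by (rule norm_unobs_ens_cov_le[OF inj u_def[unfolded H]])
  also have "\<dots> \<le> X * (opnorm H * norm w)"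
    unfolding u_def by (intro mult_left_mono norm_transpose_mult_le_opnorm X)
  also have "\<dots> \<le> opnorm H * ((1 + X) * norm w)"
    using opnorm_nonneg[of H] by (simp add: algebra_simps)
  also have "\<dots> \<le> opnorm H * D"
    by (intro mult_left_mono res opnorm_nonneg)
  finally have "(norm (unobs_part \<iota> (ens_cov v *v u)))\<^sup>2 \<le> (opnorm H * D)\<^sup>2"
    by (simp add: power_mono)
  then have "(1 + 1 / e) * (norm (- unobs_part \<iota> (ens_cov v *v u)))\<^sup>2 \<le> (1 + 1 / e) * (opnorm H * D)\<^sup>2"
    using e by (intro mult_left_mono) auto
  with norm_add_sq_le[OF e, of "unobs_part \<iota> (ens_mean v)" "- unobs_part \<iota> (ens_cov v *v u)"]
  have "(norm (unobs_part \<iota> m))\<^sup>2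
      \<le> (1 + e) * (norm (unobs_part \<iota> (ens_mean v)))\<^sup>2 + (1 + 1 / e) * (opnorm H * D)\<^sup>2"
    unfolding um by linarith
  also have "\<dots> \<le> (1 + e) * (norm (ens_mean v))\<^sup>2 + (1 + 1 / e) * (opnorm H * D)\<^sup>2"
    using e norm_obs_unobs[OF inj, of "ens_mean v"] by (intro add_right_mono mult_left_mono) auto
  finally have m_le: "(norm m)\<^sup>2 \<le> 2 / r * (norm z)\<^sup>2 + 2 / r * D\<^sup>2
      + (1 + e) * (norm (ens_mean v))\<^sup>2 + (1 + 1 / e) * (opnorm H * D)\<^sup>2"
    using obs norm_obs_unobs[OF inj, of m] by linarith
  \<comment> \<open>The columns of \<open>S\<close> sum to zero, so \<open>m\<close> is the
    posterior ensemble mean and the parallel axis identity applies around it.\<close>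
  have "ens_mean (\<lambda>k. m + column k S) = m"
    using Kp by (simp add: ens_mean_def sum.distrib S_sum sum_constant_scaleR del: sum_constant)
  then have "(\<Sum>k\<in>UNIV. (norm (m + column k S))\<^sup>2) = ?K * (norm m)\<^sup>2 + (\<Sum>k\<in>UNIV. (norm (column k S))\<^sup>2)"
    using sum_norm_sq_ens_mean[of "\<lambda>k. m + column k S"] by simp
  also have "(\<Sum>k\<in>UNIV. (norm (column k S))\<^sup>2) = (?K - 1) * trace (kalman_cov H (ens_cov v))"
    using trace_spread_cov[OF K, of S] by (simp add: S_cov)
  also have "\<dots> \<le> (?K - 1) * trace (ens_cov v)"
    using K by (intro mult_left_mono trace_kalman_cov_le cov) (auto simp: ens_cov_def transpose_spread_cov)
  also have "\<dots> = (\<Sum>k\<in>UNIV. (norm (v k - ens_mean v))\<^sup>2)"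
    using trace_spread_cov[OF K, of "ens_spread v"] by (simp add: ens_cov_def column_ens_spread)
  \<comment> \<open>The spread gets the same factor as the mean, so that both recombine into the
    forecast energy.\<close>
  also have "\<dots> \<le> (1 + e) * \<dots>"
    using e by (simp add: algebra_simps sum_nonneg)
  finally have "(\<Sum>k\<in>UNIV. (norm (m + column k S))\<^sup>2)
      \<le> ?K * (norm m)\<^sup>2 + (1 + e) * (\<Sum>k\<in>UNIV. (norm (v k - ens_mean v))\<^sup>2)" by simp
  also have "?K * (norm m)\<^sup>2 \<le> ?K * (2 / r * (norm z)\<^sup>2 + 2 / r * D\<^sup>2
      + (1 + e) * (norm (ens_mean v))\<^sup>2 + (1 + 1 / e) * (opnorm H * D)\<^sup>2)"
    using m_le by (intro mult_left_mono) auto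
  finally show ?thesis
    unfolding sum_norm_sq_ens_mean[of v] by (simp add: algebra_simps)
qed

subsection \<open>Measurability of the assimilation step\<close>

lemma borel_measurable_vec_nth [measurable]:
  "f \<in> borel_measurable M \<Longrightarrow> (\<lambda>x. f x $ i) \<in> borel_measurable M"
  for f :: "'a \<Rightarrow> 'b::euclidean_space ^ 'n"
  by (erule measurable_compose)
     (auto intro!: borel_measurable_continuous_onI continuous_on_component continuous_on_id)

lemma borel_measurable_vecI:
  fixes f :: "'a \<Rightarrow> 'b::euclidean_space ^ 'n"
  assumes "\<And>i. (\<lambda>x. f x $ i) \<in> borel_measurable M"
  shows "f \<in> borel_measurable M"
proof (rule borel_measurable_euclidean_space[THEN iffD2], rule ballI)
  fix b :: "'b ^ 'n" assume "b \<in> Basis"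
  then obtain i u where b: "b = axis i u" by (auto simp: Basis_vec_def)
  show "(\<lambda>x. f x \<bullet> b) \<in> borel_measurable M"
    unfolding b inner_axis using assms by measurable
qed

lemma borel_measurable_vec_lambda [measurable]:
  fixes f :: "'a \<Rightarrow> 'n::finite \<Rightarrow> 'b::euclidean_space"
  assumes "\<And>i. (\<lambda>x. f x i) \<in> borel_measurable M"
  shows "(\<lambda>x. \<chi> i. f x i) \<in> borel_measurable M"
  by (rule borel_measurable_vecI) (simp add: assms)

lemma borel_measurable_matrix_mult [measurable]:
  fixes A :: "'a \<Rightarrow> real^'n^'m" and B :: "'a \<Rightarrow> real^'p^'n"
  assumes [measurable]: "A \<in> borel_measurable M" "B \<in> borel_measurable M"
  shows "(\<lambda>x. A x ** B x) \<in> borel_measurable M"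
  unfolding matrix_matrix_mult_def by measurable

lemma borel_measurable_matrix_vector_mult [measurable]:
  fixes A :: "'a \<Rightarrow> real^'n^'m"
  assumes [measurable]: "A \<in> borel_measurable M" "B \<in> borel_measurable M"
  shows "(\<lambda>x. A x *v B x) \<in> borel_measurable M"
  unfolding matrix_vector_mult_def by measurable

lemma borel_measurable_transpose [measurable]:
  fixes A :: "'a \<Rightarrow> real^'n^'m"
  assumes [measurable]: "A \<in> borel_measurable M"
  shows "(\<lambda>x. transpose (A x)) \<in> borel_measurable M"
  unfolding transpose_def by measurable

lemma borel_measurable_column [measurable]:
  fixes A :: "'a \<Rightarrow> real^'n^'m"
  assumes [measurable]: "A \<in> borel_measurable M"
  shows "(\<lambda>x. column k (A x)) \<in> borel_measurable M"
  unfolding column_def by measurable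

lemma borel_measurable_det [measurable]:
  fixes A :: "'a \<Rightarrow> real^'n^'n"
  assumes [measurable]: "A \<in> borel_measurable M"
  shows "(\<lambda>x. det (A x)) \<in> borel_measurable M"
  unfolding det_def by measurable

text \<open>Cramer's rule off the singular matrices; on them \<open>matrix_inv\<close> is \<open>SOME\<close> of the empty
  predicate, hence constant.\<close>

lemma matrix_inv_cramer:
  fixes A :: "real^'n^'n"
  shows "matrix_inv A = (if det A = 0 then SOME B. False
    else \<chi> i j. det (\<chi> k l. if l = i then axis j 1 $ k else A $ k $ l) / det A)"
proof (cases "det A = 0")
  case True
  then have "\<not> invertible A" by (simp add: invertible_det_nz)
  then have "(\<lambda>B. A ** B = mat 1 \<and> B ** A = mat 1) = (\<lambda>B. False)"
    unfolding invertible_def by blast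
  then show ?thesis
    using True unfolding matrix_inv_def by simp
next
  case False
  then have "A ** matrix_inv A = mat 1"
    using someI_ex[of "\<lambda>B. A ** B = mat 1 \<and> B ** A = mat 1"]
    unfolding invertible_det_nz[symmetric] invertible_def matrix_inv_def by blast
  \<comment> \<open>Column \<open>j\<close> of the inverse solves the linear system with right-hand
    side \<open>axis j 1\<close>, so Cramer's rule gives its entries.\<close>
  then have "A *v (matrix_inv A *v axis j 1) = axis j 1" for j
    by (simp add: matrix_vector_mul_assoc)
  then have "matrix_inv A *v axis j 1 =
      (\<chi> i. det (\<chi> k l. if l = i then axis j 1 $ k else A $ k $ l) / det A)" for j
    by (simp only: cramer[OF False])
  then have "matrix_inv A $ i $ j = det (\<chi> k l. if l = i then axis j 1 $ k else A $ k $ l) / det A" for i j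
    by (metis (no_types, lifting) column_def matrix_vector_mult_basis vec_lambda_beta)
  then show ?thesis using False by (simp add: vec_eq_iff)
qed

text \<open>The singular matrices are the zero set of the determinant; off it the entries are
  quotients of determinants.\<close>

lemma borel_measurable_matrix_inv [measurable]:
  fixes A :: "'a \<Rightarrow> real^'n^'n"
  assumes [measurable]: "A \<in> borel_measurable M"
  shows "(\<lambda>x. matrix_inv (A x)) \<in> borel_measurable M"
  unfolding matrix_inv_cramer by measurable

lemma borel_measurable_ens_mean [measurable]:
  fixes v :: "'a \<Rightarrow> 'k::finite \<Rightarrow> 'v::euclidean_space"
  assumes [measurable]: "\<And>k. (\<lambda>x. v x k) \<in> borel_measurable M"
  shows "(\<lambda>x. ens_mean (v x)) \<in> borel_measurable M"
  unfolding ens_mean_def by measurable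

lemma borel_measurable_ens_cov [measurable]:
  fixes v :: "'a \<Rightarrow> 'k::finite \<Rightarrow> real^'d"
  assumes [measurable]: "\<And>k. (\<lambda>x. v x k) \<in> borel_measurable M"
  shows "(\<lambda>x. ens_cov (v x)) \<in> borel_measurable M"
  unfolding ens_cov_def spread_cov_def ens_spread_def by measurable

lemma borel_measurable_kalman_mean [measurable]:
  assumes [measurable]: "C \<in> borel_measurable M" "m \<in> borel_measurable M" "z \<in> borel_measurable M"
  shows "(\<lambda>x. kalman_mean H (C x) (m x) (z x)) \<in> borel_measurable M"
  unfolding kalman_mean_def kalman_gain_def by measurable

subsection \<open>Conditional expectations of functions of the noise\<close>

text \<open>The joint law of \<open>\<omega>\<close>, seen in \<open>F\<close>, and \<open>z \<omega>\<close> agrees on rectangles with the measure built from the kernel.\<close>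

lemma (in finite_measure_subalgebra) nn_integral_conditional_kernel:
  assumes z [measurable]: "z \<in> M \<rightarrow>\<^sub>M N"
    and L: "L \<in> F \<rightarrow>\<^sub>M subprob_algebra N"
    and law: "\<And>A. A \<in> sets N \<Longrightarrow>
      AE \<omega> in M. nn_cond_exp M F (indicator {\<omega> \<in> space M. z \<omega> \<in> A}) \<omega> = emeasure (L \<omega>) A"
    and f: "case_prod f \<in> borel_measurable (F \<Otimes>\<^sub>M N)"
  shows "(\<integral>\<^sup>+\<omega>. f \<omega> (z \<omega>) \<partial>M) = (\<integral>\<^sup>+\<omega>. (\<integral>\<^sup>+y. f \<omega> y \<partial>L \<omega>) \<partial>M)"
proof (cases "space M = {}")
  \<comment> \<open>The monadic bind degenerates over an empty space, so this case is treated
    apart.\<close>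
  case True
  then show ?thesis by (simp add: nn_integral_empty)
next
  case False
  \<comment> \<open>\<open>L\<close> is a kernel over \<open>F\<close> only; restricting
    \<open>M\<close> to \<open>F\<close> makes it a kernel over the measure that is bound.\<close>
  define R where "R = restr_to_subalg M F"
  have sR [measurable_cong]: "sets R = sets F" unfolding R_def by (rule sets_restr_to_subalg[OF subalg])
  have spR: "space R = space M" unfolding R_def by (rule space_restr_to_subalg)
  have spF: "space F = space M" using subalg by (simp add: subalgebra_def)
  have intR: "(\<integral>\<^sup>+\<omega>. g \<omega> \<partial>R) = (\<integral>\<^sup>+\<omega>. g \<omega> \<partial>M)" if "g \<in> borel_measurable F" for g
    unfolding R_def by (rule nn_integral_subalgebra2[OF subalg that])
  define P where "P = distr M (F \<Otimes>\<^sub>M N) (\<lambda>\<omega>. (\<omega>, z \<omega>))"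
  define J where "J \<omega> = distr (L \<omega>) (F \<Otimes>\<^sub>M N) (\<lambda>y. (\<omega>, y))" for \<omega>
  have id [measurable]: "(\<lambda>\<omega>. \<omega>) \<in> M \<rightarrow>\<^sub>M F" using measurable_from_subalg[OF subalg measurable_ident_sets[OF refl]] .
  have J: "J \<in> R \<rightarrow>\<^sub>M subprob_algebra (F \<Otimes>\<^sub>M N)"
    unfolding J_def using L by (intro measurable_distr2[where M = N]) (auto cong: measurable_cong_sets simp: sR)
  have LsN: "sets (L \<omega>) = sets N" if "\<omega> \<in> space M" for \<omega>
    using sets_kernel[OF L] that by (simp add: spF)
  have pair: "(\<lambda>y. (\<omega>, y)) \<in> L \<omega> \<rightarrow>\<^sub>M F \<Otimes>\<^sub>M N" if "\<omega> \<in> space M" for \<omega>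
    unfolding measurable_cong_sets[OF LsN[OF that] refl]
    using that by (intro measurable_Pair1') (simp add: spF)
  have "P = R \<bind> J"
  \<comment> \<open>Uniqueness of finite measures on the intersection-stable family of measurable
    rectangles.\<close>
  proof (rule measure_eqI_generator_eq[OF Int_stable_pair_measure_generator[of F N]])
    show "{a \<times> b |a b. a \<in> sets F \<and> b \<in> sets N} \<subseteq> Pow (space F \<times> space N)"
      by (rule pair_measure_closed)
    show "sets P = sigma_sets (space F \<times> space N) {a \<times> b |a b. a \<in> sets F \<and> b \<in> sets N}"
      by (simp add: P_def sets_pair_measure)
    show "sets (R \<bind> J) = sigma_sets (space F \<times> space N) {a \<times> b |a b. a \<in> sets F \<and> b \<in> sets N}"
      using sets_bind_measurable[OF J] False by (simp add: spR sets_pair_measure)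
    show "range (\<lambda>_::nat. space F \<times> space N) \<subseteq> {a \<times> b |a b. a \<in> sets F \<and> b \<in> sets N}" by auto
    show "(\<Union>i::nat. space F \<times> space N) = space F \<times> space N" by simp
    show "emeasure P (space F \<times> space N) \<noteq> \<infinity>" 
      by (simp add: P_def emeasure_distr)
  next
    fix X assume "X \<in> {a \<times> b |a b. a \<in> sets F \<and> b \<in> sets N}"
    then obtain W A where X: "X = W \<times> A" and W [measurable]: "W \<in> sets F" and A [measurable]: "A \<in> sets N" by auto
    have XFN: "X \<in> sets (F \<Otimes>\<^sub>M N)" unfolding X by measurable
    have WM [measurable]: "W \<in> sets M" using subalg W by (auto simp: subalgebra_def)
    have "emeasure P X = emeasure M {\<omega> \<in> space M. \<omega> \<in> W \<and> z \<omega> \<in> A}"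
      unfolding P_def X by (subst emeasure_distr) (auto intro!: arg_cong[where f = "emeasure M"])
    also have "\<dots> = (\<integral>\<^sup>+\<omega>. indicator {\<omega> \<in> space M. \<omega> \<in> W \<and> z \<omega> \<in> A} \<omega> \<partial>M)"
      by (rule nn_integral_indicator[symmetric]) measurable
    also have "\<dots> = (\<integral>\<^sup>+\<omega>. indicator W \<omega> * indicator {\<omega> \<in> space M. z \<omega> \<in> A} \<omega> \<partial>M)"
      by (rule nn_integral_cong) (auto split: split_indicator)
    \<comment> \<open>Defining property of the conditional expectation, with the
      \<open>F\<close>-measurable weight \<open>indicator W\<close>.\<close>
    also have "\<dots> = (\<integral>\<^sup>+\<omega>. indicator W \<omega> * nn_cond_exp M F (indicator {\<omega> \<in> space M. z \<omega> \<in> A}) \<omega> \<partial>M)"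
      by (rule nn_cond_exp_intg[symmetric]) measurable
    also have "\<dots> = (\<integral>\<^sup>+\<omega>. indicator W \<omega> * emeasure (L \<omega>) A \<partial>M)"
      using law[OF A] by (intro nn_integral_cong_AE) auto
    also have "\<dots> = (\<integral>\<^sup>+\<omega>. indicator W \<omega> * emeasure (L \<omega>) A \<partial>R)"
      by (intro intR[symmetric] borel_measurable_times_ennreal borel_measurable_indicator W
          measurable_emeasure_kernel[OF L A])
    also have "\<dots> = (\<integral>\<^sup>+\<omega>. emeasure (J \<omega>) X \<partial>R)"
    proof (rule nn_integral_cong)
      fix \<omega> assume "\<omega> \<in> space R"
      then have \<omega>: "\<omega> \<in> space M" by (simp add: spR)
      have "(\<lambda>y. (\<omega>, y)) -` X \<inter> space (L \<omega>) = (if \<omega> \<in> W then A else {})"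
        using sets.sets_into_space[OF A] sets_eq_imp_space_eq[OF LsN[OF \<omega>]] by (auto simp: X)
      then show "indicator W \<omega> * emeasure (L \<omega>) A = emeasure (J \<omega>) X"
        unfolding J_def emeasure_distr[OF pair[OF \<omega>] XFN] by simp
    qed
    also have "\<dots> = emeasure (R \<bind> J) X"
      using False by (intro emeasure_bind[symmetric, OF _ J XFN]) (simp add: spR)
    finally show "emeasure P X = emeasure (R \<bind> J) X" .
  qed
  have "(\<integral>\<^sup>+\<omega>. f \<omega> (z \<omega>) \<partial>M) = (\<integral>\<^sup>+p. case_prod f p \<partial>P)"
    unfolding P_def using f by (subst nn_integral_distr) auto
  also have "\<dots> = (\<integral>\<^sup>+\<omega>. (\<integral>\<^sup>+p. case_prod f p \<partial>J \<omega>) \<partial>R)"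
    unfolding \<open>P = R \<bind> J\<close> by (rule nn_integral_bind[OF f J])
  also have "\<dots> = (\<integral>\<^sup>+\<omega>. (\<integral>\<^sup>+y. f \<omega> y \<partial>L \<omega>) \<partial>R)"
  proof (rule nn_integral_cong)
    fix \<omega> assume "\<omega> \<in> space R"
    then have \<omega>: "\<omega> \<in> space M" by (simp add: spR)
    show "(\<integral>\<^sup>+p. case_prod f p \<partial>J \<omega>) = (\<integral>\<^sup>+y. f \<omega> y \<partial>L \<omega>)"
      using f unfolding J_def by (subst nn_integral_distr[OF pair[OF \<omega>]]) simp_all
  qed
  also have "\<dots> = (\<integral>\<^sup>+\<omega>. (\<integral>\<^sup>+y. f \<omega> y \<partial>L \<omega>) \<partial>M)"
    using f by (intro intR nn_integral_measurable_subprob_algebra2[OF _ L]) (simp add: case_prod_unfold)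
  finally show ?thesis .
qed

text \<open>The law is given relative to \<open>G\<close>, the expectation is taken relative to the
  smaller \<open>F\<close>. As the kernel depends on an \<open>F\<close>-measurable
  \<open>u\<close>, the integral against it is \<open>F\<close>-measurable, and testing on sets of
  \<open>F\<close> characterises it.\<close>

lemma (in finite_measure) nn_cond_exp_kernel:
  assumes G: "subalgebra M G" and F: "subalgebra G F"
    and z [measurable]: "z \<in> M \<rightarrow>\<^sub>M N"
    and u [measurable]: "u \<in> F \<rightarrow>\<^sub>M B" and k: "k \<in> B \<rightarrow>\<^sub>M subprob_algebra N"
    and law: "\<And>A. A \<in> sets N \<Longrightarrow>
      AE \<omega> in M. nn_cond_exp M G (indicator {\<omega> \<in> space M. z \<omega> \<in> A}) \<omega> = emeasure (k (u \<omega>)) A"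
    and f [measurable]: "case_prod f \<in> borel_measurable (B \<Otimes>\<^sub>M N)"
  shows "AE \<omega> in M. (\<integral>\<^sup>+y. f (u \<omega>) y \<partial>k (u \<omega>)) = nn_cond_exp M F (\<lambda>\<omega>. f (u \<omega>) (z \<omega>)) \<omega>"
proof -
  have MF: "subalgebra M F" using F G by (auto simp: subalgebra_def)
  interpret G: finite_measure_subalgebra M G by unfold_locales (rule G)
  interpret F: finite_measure_subalgebra M F by unfold_locales (rule MF)
  have uG [measurable]: "u \<in> G \<rightarrow>\<^sub>M B" by (rule measurable_from_subalg[OF F u])
  have uM [measurable]: "u \<in> M \<rightarrow>\<^sub>M B" by (rule measurable_from_subalg[OF G uG])
  have kf: "(\<lambda>b. \<integral>\<^sup>+y. f b y \<partial>k b) \<in> borel_measurable B"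
    using f by (intro nn_integral_measurable_subprob_algebra2[OF _ k]) (simp add: case_prod_unfold)
  show ?thesis
  proof (rule F.nn_cond_exp_charact)
    fix A assume A: "A \<in> sets F"
    then have [measurable]: "A \<in> sets G" using F by (auto simp: subalgebra_def)
    have [measurable]: "(\<lambda>p. f (u (fst p)) (snd p)) \<in> borel_measurable (G \<Otimes>\<^sub>M N)"
      using measurable_compose[OF _ f, of "\<lambda>p. (u (fst p), snd p)"] by simp
    have "(\<integral>\<^sup>+\<omega>\<in>A. f (u \<omega>) (z \<omega>) \<partial>M) = (\<integral>\<^sup>+\<omega>. (\<integral>\<^sup>+y. f (u \<omega>) y * indicator A \<omega> \<partial>k (u \<omega>)) \<partial>M)"
      by (rule G.nn_integral_conditional_kernel[OF z measurable_compose[OF uG k] law])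
         (simp_all add: case_prod_unfold)
    also have "\<dots> = (\<integral>\<^sup>+\<omega>\<in>A. (\<integral>\<^sup>+y. f (u \<omega>) y \<partial>k (u \<omega>)) \<partial>M)"
      by (intro nn_integral_cong) (auto split: split_indicator)
    finally show "(\<integral>\<^sup>+\<omega>\<in>A. f (u \<omega>) (z \<omega>) \<partial>M) = (\<integral>\<^sup>+\<omega>\<in>A. (\<integral>\<^sup>+y. f (u \<omega>) y \<partial>k (u \<omega>)) \<partial>M)" .
  next
    show "(\<lambda>\<omega>. f (u \<omega>) (z \<omega>)) \<in> borel_measurable M" by measurable
    show "(\<lambda>\<omega>. \<integral>\<^sup>+y. f (u \<omega>) y \<partial>k (u \<omega>)) \<in> borel_measurable F"
      using measurable_compose[OF u kf] .
  qed
qed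

section \<open>Linearity of the nonnegative conditional expectation\<close>

lemma (in sigma_finite_subalgebra) nn_cond_exp_cmult:
  assumes "f \<in> borel_measurable M"
  shows "AE \<omega> in M. nn_cond_exp M F (\<lambda>\<omega>. c * f \<omega>) \<omega> = c * nn_cond_exp M F f \<omega>"
  using nn_cond_exp_prod[of "\<lambda>_. c" f] assms by auto

lemma (in sigma_finite_subalgebra) nn_cond_exp_add:
  assumes "f \<in> borel_measurable M" "g \<in> borel_measurable M"
  shows "AE \<omega> in M. nn_cond_exp M F (\<lambda>\<omega>. f \<omega> + g \<omega>) \<omega> = nn_cond_exp M F f \<omega> + nn_cond_exp M F g \<omega>"
  using nn_cond_exp_sum[of f g] assms by auto

lemma (in sigma_finite_subalgebra) nn_cond_exp_finite_sum:
  assumes "finite I" "\<And>i. i \<in> I \<Longrightarrow> f i \<in> borel_measurable M"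
  shows "AE \<omega> in M. nn_cond_exp M F (\<lambda>\<omega>. \<Sum>i\<in>I. f i \<omega>) \<omega> = (\<Sum>i\<in>I. nn_cond_exp M F (f i) \<omega>)"
  using assms
proof (induction I)
  case empty
  then show ?case using nn_cond_exp_F_meas[of "\<lambda>_. 0"] by auto
next
  case (insert i I)
  then have "AE \<omega> in M. nn_cond_exp M F (\<lambda>\<omega>. f i \<omega> + (\<Sum>i\<in>I. f i \<omega>)) \<omega>
      = nn_cond_exp M F (f i) \<omega> + nn_cond_exp M F (\<lambda>\<omega>. \<Sum>i\<in>I. f i \<omega>) \<omega>"
    by (intro nn_cond_exp_add) auto
  with insert show ?case by auto
qed

text \<open>The cross term vanishes because the noise is centred, and the integral of
  \<open>(norm z)\<^sup>2\<close> is the trace of the second moment matrix. The value is the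
  left-hand side of the energy principle when \<open>a\<close> is the drift.\<close>

lemma nn_integral_norm_add_sq:
  fixes \<mu> :: "(real^'d) measure"
  assumes "prob_space \<mu>" and sets [measurable_cong]: "sets \<mu> = sets borel"
    and sq: "integrable \<mu> (\<lambda>z. (norm z)\<^sup>2)" and mean: "(\<integral>z. z \<partial>\<mu>) = 0"
  shows "(\<integral>\<^sup>+z. ennreal ((norm (a + z))\<^sup>2) \<partial>\<mu>) = ennreal ((norm a)\<^sup>2 + trace (second_moment \<mu>))"
proof -
  interpret prob_space \<mu> by fact
  have int: "integrable \<mu> (\<lambda>z. z)"
  proof (rule Bochner_Integration.integrable_bound[where f = "\<lambda>z. 1 + (norm z)\<^sup>2"])
    show "AE z in \<mu>. norm z \<le> norm (1 + (norm z)\<^sup>2)"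
    proof (rule AE_I2)
      fix z :: "real^'d"
      \<comment> \<open>Gives \<open>2 * norm z \<le> 1 + (norm z)\<^sup>2\<close>, so the second
        moment also makes the mean integrable.\<close>
      have "0 \<le> (norm z - 1)\<^sup>2" by simp
      then show "norm z \<le> norm (1 + (norm z)\<^sup>2)"
        unfolding power2_diff by simp (smt (verit) norm_ge_zero)
    qed
  qed (use sq in auto)
  have comp: "integrable \<mu> (\<lambda>z. z $ i * z $ i)" for i
  proof (rule Bochner_Integration.integrable_bound[OF sq])
    show "AE z in \<mu>. norm (z $ i * z $ i) \<le> norm ((norm z)\<^sup>2)"
      by (intro AE_I2)
         (simp add: component_le_norm_cart abs_le_square_iff[symmetric] flip: power2_eq_square)
  qed measurable
  have tr: "trace (second_moment \<mu>) = (\<integral>z. (norm z)\<^sup>2 \<partial>\<mu>)"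
    unfolding power2_norm_eq_inner inner_vec_def
    by (simp add: trace_def second_moment_def comp)
  have eq: "(norm (a + z))\<^sup>2 = (norm a)\<^sup>2 + 2 * (a \<bullet> z) + (norm z)\<^sup>2" for z
    by (simp add: power2_norm_eq_inner inner_add inner_commute)
  have i2: "integrable \<mu> (\<lambda>z. (norm (a + z))\<^sup>2)"
    unfolding eq using int sq by simp
  have "(\<integral>z. (norm (a + z))\<^sup>2 \<partial>\<mu>) = (norm a)\<^sup>2 + trace (second_moment \<mu>)"
    unfolding eq tr using int sq mean by (simp add: prob_space)
  then show ?thesis
    using nn_integral_eq_integral[OF i2] by simp
qed

section \<open>Moments of the standard Gaussian\<close>

lemma nn_integral_std_gaussian_prod:
  fixes f :: "'q::finite \<Rightarrow> real \<Rightarrow> real"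
  assumes [measurable]: "\<And>j. f j \<in> borel_measurable borel" and "\<And>j t. 0 \<le> f j t"
  shows "(\<integral>\<^sup>+x. ennreal (\<Prod>j\<in>UNIV. f j (x $ j)) \<partial>std_gaussian)
       = (\<Prod>j\<in>UNIV. \<integral>\<^sup>+t. ennreal (f j t * std_normal_density t) \<partial>lborel)"
proof -
  \<comment> \<open>Lebesgue measure factorises over \<open>Basis\<close>; \<open>b\<close> carries
    this product to the coordinate indices.\<close>
  define b where "b j = axis j (1::real)" for j :: 'q
  have inj: "inj b" by (auto simp: b_def inj_def axis_eq_axis)
  have B: "Basis = range b" by (auto simp: b_def Basis_vec_def)
  define g where "g c t = ennreal (f (inv b c) t * std_normal_density t)" for c t
  have "(\<integral>\<^sup>+x. ennreal (\<Prod>j\<in>UNIV. f j (x $ j)) \<partial>std_gaussian)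
      = (\<integral>\<^sup>+x. (\<Prod>j\<in>UNIV. g (b j) (x \<bullet> b j)) \<partial>lborel)"
    unfolding std_gaussian_def using assms(2)
    by (subst nn_integral_density)
       (auto simp: g_def inj b_def[symmetric] prod_ennreal[symmetric] prod.distrib ennreal_mult' mult.commute
         prod_nonneg cart_eq_inner_axis intro!: nn_integral_cong)
  also have "\<dots> = (\<integral>\<^sup>+x. (\<Prod>c\<in>Basis. g c (x \<bullet> c)) \<partial>lborel)"
    by (simp add: B prod.reindex inj)
  also have "\<dots> = (\<Prod>c\<in>Basis. \<integral>\<^sup>+t. g c t \<partial>lborel)"
    by (rule nn_integral_lborel_prod) (auto simp: g_def)
  also have "\<dots> = (\<Prod>j\<in>UNIV. \<integral>\<^sup>+t. ennreal (f j t * std_normal_density t) \<partial>lborel)"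
    by (simp add: B prod.reindex inj g_def)
  finally show ?thesis .
qed

lemma nn_integral_std_normal_density: "(\<integral>\<^sup>+t. ennreal (std_normal_density t) \<partial>lborel) = 1"
  using std_normal_moment_even[of 0]
  by (subst nn_integral_eq_integral) (auto simp: has_bochner_integral_iff)

lemma sets_std_gaussian [measurable_cong]: "sets std_gaussian = sets borel"
  by (simp add: std_gaussian_def)

lemma prob_space_std_gaussian: "prob_space (std_gaussian :: (real^'q::finite) measure)"
proof
  show "emeasure (std_gaussian :: (real^'q) measure) (space std_gaussian) = 1"
    using nn_integral_std_gaussian_prod[where f = "\<lambda>(_::'q) _. 1"]
    by (simp add: nn_integral_std_normal_density)
qed

lemma second_moment_std_gaussian_finite:
  "(\<integral>\<^sup>+x. ennreal ((norm x)\<^sup>2) \<partial>(std_gaussian :: (real^'q::finite) measure)) < \<infinity>"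
proof -
  have "(\<integral>\<^sup>+x. ennreal ((x $ i)\<^sup>2) \<partial>(std_gaussian :: (real^'q) measure)) < \<infinity>" for i
  proof -
    \<comment> \<open>The square of one coordinate as a product over all coordinates: a second
      moment at \<open>i\<close>, a total mass elsewhere.\<close>
    define f :: "'q \<Rightarrow> real \<Rightarrow> real" where "f j t = (if j = i then t\<^sup>2 else 1)" for j t
    have "(\<integral>\<^sup>+x. ennreal ((x $ i)\<^sup>2) \<partial>(std_gaussian :: (real^'q) measure))
        = (\<integral>\<^sup>+x. ennreal (\<Prod>j\<in>UNIV. f j (x $ j)) \<partial>std_gaussian)"
      by (simp add: f_def)
    also have "\<dots> = (\<Prod>j\<in>UNIV. \<integral>\<^sup>+t. ennreal (f j t * std_normal_density t) \<partial>lborel)"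
      by (rule nn_integral_std_gaussian_prod) (auto simp: f_def)
    also have "\<dots> < \<infinity>"
    proof -
      have "(\<integral>\<^sup>+t. ennreal (t\<^sup>2 * std_normal_density t) \<partial>lborel) < \<infinity>"
        using integrable_std_normal_moment[of 2]
        by (subst nn_integral_eq_integral) (auto simp: mult.commute)
      then have "(\<integral>\<^sup>+t. ennreal (f j t * std_normal_density t) \<partial>lborel) \<noteq> \<infinity>" for j
        by (cases "j = i") (auto simp: f_def nn_integral_std_normal_density)
      then show ?thesis
        unfolding infinity_ennreal_def less_top[symmetric] ennreal_prod_eq_top by blast
    qed
    finally show ?thesis .
  qed
  moreover have "(\<integral>\<^sup>+x. ennreal ((norm x)\<^sup>2) \<partial>(std_gaussian :: (real^'q) measure))
      = (\<Sum>i\<in>UNIV. \<integral>\<^sup>+x. ennreal ((x $ i)\<^sup>2) \<partial>(std_gaussian :: (real^'q) measure))"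
    unfolding power2_norm_eq_inner inner_vec_def
    by (subst nn_integral_sum[symmetric]) (auto simp: power2_eq_square intro!: nn_integral_cong)
  ultimately show ?thesis by (simp add: less_top)
qed

lemma trace_second_moment_nonneg: "0 \<le> trace (second_moment \<mu>)"
  by (simp add: trace_def second_moment_def sum_nonneg)

subsection \<open>The filtrations and the conditional noise law\<close>

text \<open>The family \<open>preimages M X\<close> is the \<sigma>-algebra generated by
  \<open>X\<close>, so inclusions of generators can be read as measurability.\<close>

lemma preimages_subset_iff:
  assumes "space N = space M"
  shows "preimages M X \<subseteq> sets N \<longleftrightarrow> X \<in> borel_measurable N"
  using assms by (auto simp: preimages_def measurable_def)

lemma preimages_subset_Pow: "preimages M X \<subseteq> Pow (space M)"
  by (auto simp: preimages_def)

lemma subalgebra_sigma_iff: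
  assumes "A \<subseteq> Pow (space N)"
  shows "subalgebra N (sigma (space N) A) \<longleftrightarrow> A \<subseteq> sets N"
proof -
  have "sigma_sets (space N) A \<subseteq> sets N \<longleftrightarrow> A \<subseteq> sets N"
    using sets.sigma_sets_subset[of A N] sigma_sets_superset_generator[of A "space N"] by auto
  then show ?thesis
    by (simp add: subalgebra_def space_measure_of_conv sets_measure_of[OF assms])
qed

lemma space_noise_algebra [simp]: "space (noise_algebra M u0 v0 \<zeta> \<eta> \<xi> n) = space M"
  by (simp add: noise_algebra_def space_measure_of_conv)

text \<open>Used in three ways: with \<open>N\<close> the full space it places the past inside
  \<open>M\<close>, with \<open>N\<close> the algebra itself it gives measurability of the noises,
  and with \<open>N\<close> at a later time it gives monotonicity of the filtration.\<close>

lemma subalgebra_noise_algebra_iff: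
  assumes N: "space N = space M"
  shows "subalgebra N (noise_algebra M u0 v0 \<zeta> \<eta> \<xi> n) \<longleftrightarrow>
    u0 \<in> borel_measurable N \<and> (\<forall>k. v0 k \<in> borel_measurable N) \<and>
    (\<forall>m\<in>{1..n}. \<zeta> m \<in> borel_measurable N \<and> (\<forall>k. \<eta> m k \<in> borel_measurable N) \<and> \<xi> m \<in> borel_measurable N)"
proof -
  let ?A = "preimages M u0 \<union> (\<Union>k. preimages M (v0 k)) \<union>
    (\<Union>m\<in>{1..n}. preimages M (\<zeta> m) \<union> (\<Union>k. preimages M (\<eta> m k)) \<union> preimages M (\<xi> m))"
  have "?A \<subseteq> Pow (space N)"
    unfolding N by (intro Un_least UN_least preimages_subset_Pow)
  then have "subalgebra N (noise_algebra M u0 v0 \<zeta> \<eta> \<xi> n) \<longleftrightarrow> ?A \<subseteq> sets N"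
    unfolding noise_algebra_def N[symmetric] by (rule subalgebra_sigma_iff)
  then show ?thesis
    unfolding Un_subset_iff UN_subset_iff preimages_subset_iff[OF N] by blast
qed

lemma space_state_algebra [simp]: "space (state_algebra M U V n) = space M"
  by (simp add: state_algebra_def space_measure_of_conv)

lemma subalgebra_state_algebra_iff:
  assumes N: "space N = space M"
  shows "subalgebra N (state_algebra M U V n) \<longleftrightarrow>
    (\<forall>m\<in>{0..n}. U m \<in> borel_measurable N \<and> (\<forall>k. V m k \<in> borel_measurable N))"
proof -
  let ?A = "\<Union>m\<in>{0..n}. preimages M (U m) \<union> (\<Union>k. preimages M (V m k))"
  have "?A \<subseteq> Pow (space N)"
    unfolding N by (intro Un_least UN_least preimages_subset_Pow)
  then have "subalgebra N (state_algebra M U V n) \<longleftrightarrow> ?A \<subseteq> sets N"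
    unfolding state_algebra_def N[symmetric] by (rule subalgebra_sigma_iff)
  then show ?thesis
    unfolding Un_subset_iff UN_subset_iff preimages_subset_iff[OF N] by blast
qed

lemma emeasure_UNIV_prob_borel:
  assumes "prob_space \<mu>" "sets \<mu> = sets borel"
  shows "emeasure \<mu> UNIV = 1"
  using prob_space.emeasure_space_1[OF assms(1)] sets_eq_imp_space_eq[OF assms(2)] by simp

context
  fixes M G :: "'w measure" and \<kappa> :: "real^'d::finite \<Rightarrow> (real^'d) measure"
    and u z :: "'w \<Rightarrow> real^'d" and v e :: "'k::finite \<Rightarrow> 'w \<Rightarrow> real^'d" and x :: "'w \<Rightarrow> real^'q::finite"
  assumes law: "cond_noise_law M G \<kappa> u v z e x"
    and \<kappa>: "\<And>a. prob_space (\<kappa> a)" "\<And>a. sets (\<kappa> a) = sets borel"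
begin

text \<open>Marginal of the joint conditional law: the events of all other variables are the whole
  space and contribute factors 1.\<close>

lemma cond_noise_law_signal:
  assumes "A \<in> sets borel"
  shows "AE \<omega> in M. nn_cond_exp M G (indicator {\<omega> \<in> space M. z \<omega> \<in> A}) \<omega> = emeasure (\<kappa> (u \<omega>)) A"
  using law[unfolded cond_noise_law_def, rule_format, of A "\<lambda>_. UNIV" UNIV] assms
  by (simp add: emeasure_UNIV_prob_borel[OF \<kappa>]
      emeasure_UNIV_prob_borel[OF prob_space_std_gaussian sets_std_gaussian])

lemma cond_noise_law_ensemble:
  assumes "A \<in> sets borel"
  shows "AE \<omega> in M. nn_cond_exp M G (indicator {\<omega> \<in> space M. e k \<omega> \<in> A}) \<omega> = emeasure (\<kappa> (v k \<omega>)) A"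
proof -
  have "(\<Prod>l\<in>UNIV. emeasure (\<kappa> (v l \<omega>)) (if l = k then A else UNIV)) = emeasure (\<kappa> (v k \<omega>)) A" for \<omega>
    by (subst prod.remove[of _ k]) (simp_all add: emeasure_UNIV_prob_borel[OF \<kappa>])
  moreover have "(\<forall>l. e l \<omega> \<in> (if l = k then A else UNIV)) \<longleftrightarrow> e k \<omega> \<in> A" for \<omega>
    by auto
  ultimately show ?thesis
    using law[unfolded cond_noise_law_def, rule_format, of UNIV "\<lambda>l. if l = k then A else UNIV" UNIV] assms
    by (simp add: emeasure_UNIV_prob_borel[OF \<kappa>]
      emeasure_UNIV_prob_borel[OF prob_space_std_gaussian sets_std_gaussian])
qed

lemma cond_noise_law_observation:
  assumes "C \<in> sets borel"
  shows "AE \<omega> in M. nn_cond_exp M G (indicator {\<omega> \<in> space M. x \<omega> \<in> C}) \<omega> = emeasure std_gaussian C"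
  using law[unfolded cond_noise_law_def, rule_format, of UNIV "\<lambda>_. UNIV" C] assms
  by (simp add: emeasure_UNIV_prob_borel[OF \<kappa>])

end

text \<open>The kernel formula combined with the second moment of a shifted centred noise. It
  applies to the signal and to each forecast member alike.\<close>

lemma (in finite_measure) nn_cond_exp_norm_add_noise_sq:
  fixes \<kappa> :: "real^'d::finite \<Rightarrow> (real^'d) measure"
  assumes "subalgebra M G" "subalgebra G F" "z \<in> borel_measurable M" "u \<in> borel_measurable F"
    and \<kappa>: "\<kappa> \<in> borel \<rightarrow>\<^sub>M prob_algebra borel"
    and int: "\<And>a. integrable (\<kappa> a) (\<lambda>z. (norm z)\<^sup>2)" and mean: "\<And>a. (\<integral>z. z \<partial>\<kappa> a) = 0"
    and [measurable]: "\<Psi> \<in> borel_measurable borel"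
    and law: "\<And>A. A \<in> sets borel \<Longrightarrow>
      AE \<omega> in M. nn_cond_exp M G (indicator {\<omega> \<in> space M. z \<omega> \<in> A}) \<omega> = emeasure (\<kappa> (u \<omega>)) A"
    and y: "y \<in> borel_measurable M" "\<And>\<omega>. \<omega> \<in> space M \<Longrightarrow> y \<omega> = \<Psi> (u \<omega>) + z \<omega>"
  shows "AE \<omega> in M. nn_cond_exp M F (\<lambda>\<omega>. ennreal ((norm (y \<omega>))\<^sup>2)) \<omega>
    = ennreal ((norm (\<Psi> (u \<omega>)))\<^sup>2 + trace (second_moment (\<kappa> (u \<omega>))))"
proof -
  have MF: "subalgebra M F" using assms(1,2) by (auto simp: subalgebra_def)
  interpret F: finite_measure_subalgebra M F by unfold_locales (rule MF)
  have [measurable]: "z \<in> borel_measurable M" "u \<in> borel_measurable M" "y \<in> borel_measurable M"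
    using assms(3,4) measurable_from_subalg[OF MF] y by auto
  have "\<kappa> a \<in> space (prob_algebra borel)" for a
    using measurable_space[OF \<kappa>, of a] by simp
  then have k: "prob_space (\<kappa> a)" "sets (\<kappa> a) = sets borel" for a
    by (auto simp: space_prob_algebra)
  have "AE \<omega> in M. (\<integral>\<^sup>+t. ennreal ((norm (\<Psi> (u \<omega>) + t))\<^sup>2) \<partial>\<kappa> (u \<omega>))
      = nn_cond_exp M F (\<lambda>\<omega>. ennreal ((norm (\<Psi> (u \<omega>) + z \<omega>))\<^sup>2)) \<omega>"
    using law
  proof (rule nn_cond_exp_kernel[OF assms(1-4) measurable_prob_algebraD[OF \<kappa>]])
    show "(\<lambda>(a, t). ennreal ((norm (\<Psi> a + t))\<^sup>2)) \<in> borel_measurable (borel \<Otimes>\<^sub>M borel)"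
      by measurable
  qed
  moreover have "AE \<omega> in M. nn_cond_exp M F (\<lambda>\<omega>. ennreal ((norm (\<Psi> (u \<omega>) + z \<omega>))\<^sup>2)) \<omega>
      = nn_cond_exp M F (\<lambda>\<omega>. ennreal ((norm (y \<omega>))\<^sup>2)) \<omega>"
    by (rule F.nn_cond_exp_cong) (auto simp: y(2))
  ultimately show ?thesis
    by eventually_elim (simp add: nn_integral_norm_add_sq[OF k int mean])
qed

subsection \<open>Energy estimate\<close>

text \<open>A level that dominates the initial value and is not exceeded by the affine map is never
  exceeded by the sequence.\<close>

lemma ennreal_affine_recursion_bounded:
  fixes x :: "nat \<Rightarrow> ennreal"
  assumes rec: "\<And>n. x (Suc n) \<le> ennreal q * x n + ennreal d"
    and q: "0 \<le> q" "q < 1" and d: "0 \<le> d" and x0: "x 0 < \<infinity>"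
  shows "(SUP n. x n) < \<infinity>"
proof -
  obtain c where c: "x 0 = ennreal c" "0 \<le> c"
    using x0 by (cases "x 0") auto
  \<comment> \<open>The fixed point \<open>d / (1 - q)\<close> of the affine map, raised by the
    initial value \<open>c\<close>.\<close>
  define b where "b = c + d / (1 - q)"
  have b0: "b \<ge> 0" using q d c(2) by (simp add: b_def)
  have "(1 - q) * b = (1 - q) * c + d"
    using q by (simp add: b_def distrib_left)
  moreover have "(1 - q) * c \<ge> 0" using q c(2) by simp
  ultimately have "q * b + d \<le> b" by (simp add: left_diff_distrib)
  note b = b0 this
  have "x n \<le> ennreal b" for n
  proof (induction n)
    case 0
    show ?case using q d by (simp add: c b_def ennreal_leI)
  next
    case (Suc n)
    have "x (Suc n) \<le> ennreal q * ennreal b + ennreal d"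
      using rec[of n] Suc by (meson add_right_mono mult_left_mono order_trans zero_le)
    also have "\<dots> = ennreal (q * b + d)"
      using q b d by (simp add: ennreal_mult)
    also have "\<dots> \<le> ennreal b" using b by (intro ennreal_leI)
    finally show ?case .
  qed
  then have "(SUP n. x n) \<le> ennreal b" by (intro SUP_least)
  then show ?thesis by (rule le_less_trans) simp
qed

theorem theorem4p5:
  fixes M :: "'w measure"
    and \<Psi> :: "real^'d \<Rightarrow> real^'d"
    and \<kappa> :: "real^'d \<Rightarrow> (real^'d) measure"
    and R :: "real^'d \<Rightarrow> real^'d^'d"
    and \<iota> :: "'q::finite \<Rightarrow> 'd::finite" and h :: "'q \<Rightarrow> real" and H :: "real^'d^'q"
    and c M1 M2 \<beta> Kh \<rho>0 :: real
    and U \<zeta> :: "nat \<Rightarrow> 'w \<Rightarrow> real^'d"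
    and V Vf \<zeta>e :: "nat \<Rightarrow> 'k::finite \<Rightarrow> 'w \<Rightarrow> real^'d"
    and Z \<xi> :: "nat \<Rightarrow> 'w \<Rightarrow> real^'q"
    and lam :: "nat \<Rightarrow> 'w \<Rightarrow> real"
    and Vmean :: "nat \<Rightarrow> 'w \<Rightarrow> real^'d"
    and S :: "nat \<Rightarrow> 'w \<Rightarrow> real^'k^'d"
    and F G :: "nat \<Rightarrow> 'w measure"
    and E :: "nat \<Rightarrow> 'w \<Rightarrow> real"
  assumes "prob_space M"
    and G_def: "\<And>n. G n = noise_algebra M (U 0) (V 0) \<zeta> \<zeta>e \<xi> n"
    and F_def: "\<And>n. F n = state_algebra M U V n"
    \<comment> \<open>model: drift, noise kernel, conditional mean and covariance of the noise\<close>
    and "\<Psi> \<in> borel_measurable borel"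
    and "\<kappa> \<in> borel \<rightarrow>\<^sub>M prob_algebra borel"
    and "\<And>u. integrable (\<kappa> u) (\<lambda>z. (norm z)\<^sup>2)"
    and "\<And>u. (\<integral>z. z \<partial>\<kappa> u) = 0"
    and R_def: "\<And>u. R u = second_moment (\<kappa> u)"
    \<comment> \<open>observation matrix\<close>
    and "inj \<iota>" and "\<And>j. h j > 0" and H_def: "H = obs_matrix \<iota> h"
    \<comment> \<open>initial data and noises\<close>
    and "U 0 \<in> borel_measurable M" and "\<And>k. V 0 k \<in> borel_measurable M"
    and "\<And>n. n \<ge> 1 \<Longrightarrow> \<zeta> n \<in> borel_measurable M"
    and "\<And>n k. n \<ge> 1 \<Longrightarrow> \<zeta>e n k \<in> borel_measurable M"
    and "\<And>n. n \<ge> 1 \<Longrightarrow> \<xi> n \<in> borel_measurable M"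
    and "\<And>n. n \<ge> 1 \<Longrightarrow>
           cond_noise_law M (G (n - 1)) \<kappa> (U (n - 1)) (V (n - 1)) (\<zeta> n) (\<zeta>e n) (\<xi> n)"
    \<comment> \<open>signal and observations\<close>
    and "\<And>n \<omega>. n \<ge> 1 \<Longrightarrow> \<omega> \<in> space M \<Longrightarrow> U n \<omega> = \<Psi> (U (n - 1) \<omega>) + \<zeta> n \<omega>"
    and "\<And>n \<omega>. n \<ge> 1 \<Longrightarrow> \<omega> \<in> space M \<Longrightarrow> Z n \<omega> = H *v U n \<omega> + \<xi> n \<omega>"
    \<comment> \<open>forecast ensemble\<close>
    and "CARD('k) \<ge> 2"
    and "\<And>n k \<omega>. n \<ge> 1 \<Longrightarrow> \<omega> \<in> space M \<Longrightarrow> Vf n k \<omega> = \<Psi> (V (n - 1) k \<omega>) + \<zeta>e n k \<omega>"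
    \<comment> \<open>inflation\<close>
    and "c > 0" and "M1 > 0" and "M2 > 0"
    and "\<And>n. n \<ge> 1 \<Longrightarrow> lam n \<in> borel_measurable (G n)"
    and "\<And>n. n \<ge> 1 \<Longrightarrow> AE \<omega> in M. lam n \<omega> \<ge>
           inflation_fn c M1 M2 (innovation_stat H (\<lambda>k. Vf n k \<omega>) (Z n \<omega>))
             (cross_cov_stat \<iota> (\<lambda>k. Vf n k \<omega>))"
    \<comment> \<open>mean update, with inflated covariance\<close>
    and "\<And>n \<omega>. n \<ge> 1 \<Longrightarrow> \<omega> \<in> space M \<Longrightarrow>
           Vmean n \<omega> = kalman_mean H (ens_cov (\<lambda>k. Vf n k \<omega>) + lam n \<omega> *\<^sub>R mat 1)
                         (ens_mean (\<lambda>k. Vf n k \<omega>)) (Z n \<omega>)"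
    \<comment> \<open>spread update, without inflation: left multiplication (EAKF) or right multiplication (ETKF)\<close>
    and "\<And>n. n \<ge> 1 \<Longrightarrow> S n \<in> borel_measurable (G n)"
    and "(\<forall>n\<ge>1. \<forall>\<omega>\<in>space M. \<exists>A :: real^'d^'d. S n \<omega> = A ** ens_spread (\<lambda>k. Vf n k \<omega>)) \<or>
         (\<forall>n\<ge>1. \<forall>\<omega>\<in>space M. \<exists>T :: real^'k^'k. S n \<omega> = ens_spread (\<lambda>k. Vf n k \<omega>) ** T)"
    and "\<And>n \<omega>. n \<ge> 1 \<Longrightarrow> \<omega> \<in> space M \<Longrightarrow>
           spread_cov (S n \<omega>) = kalman_cov H (ens_cov (\<lambda>k. Vf n k \<omega>))"
    and "\<And>n \<omega>. n \<ge> 1 \<Longrightarrow> \<omega> \<in> space M \<Longrightarrow> (\<Sum>k\<in>UNIV. column k (S n \<omega>)) = 0"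
    \<comment> \<open>posterior ensemble\<close>
    and "\<And>n k \<omega>. n \<ge> 1 \<Longrightarrow> \<omega> \<in> space M \<Longrightarrow> V n k \<omega> = Vmean n \<omega> + column k (S n \<omega>)"
    \<comment> \<open>energy principle\<close>
    and "0 < \<beta>" and "\<beta> < 1" and "Kh > 0"
    and "\<And>u. (norm (\<Psi> u))\<^sup>2 + trace (R u) \<le> (1 - \<beta>) * (norm u)\<^sup>2 + Kh"
    \<comment> \<open>energy functional; \<open>\<rho>0\<close> is the minimum eigenvalue of the diagonal matrix with entries \<open>h j ^ 2\<close>\<close>
    and \<rho>0_def: "\<rho>0 = Min (range (\<lambda>j. (h j)\<^sup>2))"
    and E_def: "\<And>n \<omega>. E n \<omega> = 4 * real CARD('k) * inverse \<rho>0 * inverse \<beta> * (opnorm H)\<^sup>2 * (norm (U n \<omega>))\<^sup>2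
                              + (\<Sum>k\<in>UNIV. (norm (V n k \<omega>))\<^sup>2)"
  shows "(\<exists>D>0. \<forall>n\<ge>1. AE \<omega> in M.
            nn_cond_exp M (F (n - 1)) (\<lambda>\<omega>. ennreal (E n \<omega>)) \<omega>
              \<le> ennreal ((1 - \<beta> / 2) * E (n - 1) \<omega> + D))
         \<and> ((\<integral>\<^sup>+\<omega>. ennreal (E 0 \<omega>) \<partial>M) < \<infinity> \<longrightarrow>
             (SUP n. \<integral>\<^sup>+\<omega>. ennreal (E n \<omega>) \<partial>M) < \<infinity>)"
proof -
  note U0 = assms(12) and V0 = assms(13) and \<zeta>M = assms(14) and \<zeta>eM = assms(15) and \<xi>M = assms(16)
  note law = assms(17) and U_eq = assms(18) and Z_eq = assms(19) and card = assms(20) and Vf_eq = assms(21)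
  note lamG = assms(25) and lam_ge = assms(26) and Vmean_eq = assms(27) and SG = assms(28)
  note S_cov = assms(30) and S_sum = assms(31) and V_eq = assms(32) and energy = assms(36)
  have \<Psi> [measurable]: "\<Psi> \<in> borel_measurable borel" by fact
  note \<kappa> = assms(5) and int = assms(6) and mean = assms(7)
  have \<beta>: "0 < \<beta>" "\<beta> < 1" and Kh: "Kh > 0" and c: "c > 0" "M1 > 0" "M2 > 0" and inj: "inj \<iota>" by fact+
  interpret prob_space M by fact

  have kp: "\<kappa> a \<in> space (prob_algebra borel)" for a
    using measurable_space[OF \<kappa>, of a] by simp
  then have k: "prob_space (\<kappa> a)" "sets (\<kappa> a) = sets borel" for a
    by (auto simp: space_prob_algebra)

  \<comment> \<open>Filtrations and adaptedness\<close>
  have MG: "subalgebra M (G n)" for n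
    unfolding G_def using U0 V0 \<zeta>M \<zeta>eM \<xi>M by (subst subalgebra_noise_algebra_iff) auto
  have spG: "space (G n) = space M" for n by (simp add: G_def)
  have "subalgebra (G n) (G n)" for n by (simp add: subalgebra_def)
  then have gen: "U 0 \<in> borel_measurable (G n) \<and> (\<forall>k. V 0 k \<in> borel_measurable (G n)) \<and>
    (\<forall>m\<in>{1..n}. \<zeta> m \<in> borel_measurable (G n) \<and> (\<forall>k. \<zeta>e m k \<in> borel_measurable (G n)) \<and> \<xi> m \<in> borel_measurable (G n))" for n
    unfolding G_def by (subst (asm) subalgebra_noise_algebra_iff) simp_all
  have GG: "subalgebra (G n) (G m)" if "m \<le> n" for m n
    unfolding G_def[of m] using gen[of n] that by (subst subalgebra_noise_algebra_iff[OF spG]) auto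

  have Vf_meas: "(\<lambda>\<omega>. Vf n k \<omega>) \<in> borel_measurable (G n)"
    and Z_meas: "Z n \<in> borel_measurable (G n)"
    if n: "n \<ge> 1" and U: "U n \<in> borel_measurable (G n)"
      and V: "\<And>k. V (n - 1) k \<in> borel_measurable (G n)" for n k
  proof -
    have [measurable]: "\<zeta>e n k \<in> borel_measurable (G n)" "\<xi> n \<in> borel_measurable (G n)" for k
      using gen[of n] n by auto
    note [measurable] = U V
    have "(\<lambda>\<omega>. \<Psi> (V (n - 1) k \<omega>) + \<zeta>e n k \<omega>) \<in> borel_measurable (G n)"
      by measurable
    then show "(\<lambda>\<omega>. Vf n k \<omega>) \<in> borel_measurable (G n)"
      by (rule measurable_cong[THEN iffD1, rotated]) (simp only: spG Vf_eq[OF n])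
    have "(\<lambda>\<omega>. H *v U n \<omega> + \<xi> n \<omega>) \<in> borel_measurable (G n)"
      by measurable
    then show "Z n \<in> borel_measurable (G n)"
      by (rule measurable_cong[THEN iffD1, rotated]) (simp only: spG Z_eq[OF n])
  qed

  \<comment> \<open>The states are adapted to the noise filtration: \<open>lam\<close> and
    \<open>S\<close> are measurable with respect to it, and everything else in a step is an explicit
    Borel function.\<close>
  have UV: "U n \<in> borel_measurable (G n) \<and> (\<forall>k. V n k \<in> borel_measurable (G n))" for n
  proof (induction n)
    case 0
    show ?case using gen[of 0] by simp
  next
    case (Suc n)
    have old: "U n \<in> borel_measurable (G (Suc n))" "V n k \<in> borel_measurable (G (Suc n))" for k
      using Suc measurable_from_subalg[OF GG[of n "Suc n"]] by auto
    note [measurable] = old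
    have [measurable]: "\<zeta> (Suc n) \<in> borel_measurable (G (Suc n))"
      using gen[of "Suc n"] by auto
    have "(\<lambda>\<omega>. \<Psi> (U n \<omega>) + \<zeta> (Suc n) \<omega>) \<in> borel_measurable (G (Suc n))"
      by measurable
    then have U [measurable]: "U (Suc n) \<in> borel_measurable (G (Suc n))"
      by (rule measurable_cong[THEN iffD1, rotated]) (simp add: spG U_eq)
    have [measurable]: "(\<lambda>\<omega>. Vf (Suc n) k \<omega>) \<in> borel_measurable (G (Suc n))" "Z (Suc n) \<in> borel_measurable (G (Suc n))" for k
      by (rule Vf_meas Z_meas; use U old in simp)+
    have [measurable]: "lam (Suc n) \<in> borel_measurable (G (Suc n))" "S (Suc n) \<in> borel_measurable (G (Suc n))"
      by (rule lamG SG; simp)+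
    have "(\<lambda>\<omega>. kalman_mean H (ens_cov (\<lambda>k. Vf (Suc n) k \<omega>) + lam (Suc n) \<omega> *\<^sub>R mat 1)
        (ens_mean (\<lambda>k. Vf (Suc n) k \<omega>)) (Z (Suc n) \<omega>) + column k (S (Suc n) \<omega>))
        \<in> borel_measurable (G (Suc n))" for k
      by measurable
    then have "V (Suc n) k \<in> borel_measurable (G (Suc n))" for k
      by (rule measurable_cong[THEN iffD1, rotated]) (simp add: spG V_eq Vmean_eq)
    with U show ?case by blast
  qed
  have UM [measurable]: "U n \<in> borel_measurable M" and VM [measurable]: "V n k \<in> borel_measurable M" for n k
    using UV[of n] measurable_from_subalg[OF MG] by auto
  have UVG: "U m \<in> borel_measurable (G n)" "V m k \<in> borel_measurable (G n)" if "m \<le> n" for m n k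
    using UV[of m] measurable_from_subalg[OF GG[OF that]] by auto
  \<comment> \<open>The noise law is known given \<open>G n\<close>, whereas the estimate conditions
    on \<open>F n\<close>; this inclusion links the two.\<close>
  have GF: "subalgebra (G n) (F n)" for n
    unfolding F_def subalgebra_state_algebra_iff[OF spG] using UVG by simp
  have MF: "subalgebra M (F n)" for n
    using MG[of n] GF[of n] by (auto simp: subalgebra_def)
  have spF: "space (F n) = space M" for n by (simp add: F_def)
  have "subalgebra (F n) (state_algebra M U V n)" for n
    unfolding F_def[symmetric] by (simp add: subalgebra_def)
  then have UVF: "U n \<in> borel_measurable (F n)" "V n k \<in> borel_measurable (F n)" for n k
    unfolding subalgebra_state_algebra_iff[OF spF] by auto
  have VfM: "Vf n k \<in> borel_measurable M" if "n \<ge> 1" for n k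
    by (rule measurable_from_subalg[OF MG Vf_meas[OF that UVG(1) UVG(2)]]) simp_all

  \<comment> \<open>Constants of the estimate\<close>
  define K where "K = real CARD('k)"
  define L where "L = opnorm H"
  define a where "a = 4 * K * inverse \<rho>0 * inverse \<beta> * L\<^sup>2"
  \<comment> \<open>Coefficient of the squared signal norm after one step: its weight
    \<open>a\<close> in the energy plus the part of
    \<open>2 * K / \<rho>0 * (norm (Z n \<omega>))\<^sup>2\<close> due to the signal, split off with
    Young parameter \<beta>. The observation noise keeps the coefficient \<open>b\<close>.\<close>
  define a1 where "a1 = a + 2 * K / \<rho>0 * (1 + \<beta>) * L\<^sup>2"
  define b where "b = 2 * K / \<rho>0 * (1 + 1 / \<beta>)"
  \<comment> \<open>\<open>D0\<close> bounds the damped residual, and \<open>d\<close> is the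
    resulting remainder of the analysis step for \<open>e = \<beta> / 2\<close>.\<close>
  define D0 where "D0 = 1 / (c * \<rho>0) + M1 * (1 + M2)"
  define d where "d = K * (2 / \<rho>0 * D0\<^sup>2 + (1 + 1 / (\<beta> / 2)) * (L * D0)\<^sup>2)"
  define m2 where "m2 = enn2real (\<integral>\<^sup>+x. ennreal ((norm x)\<^sup>2) \<partial>(std_gaussian :: (real^'q) measure))"
  define D where "D = a1 * Kh + (1 + \<beta> / 2) * (K * Kh) + b * m2 + d"
  have m2: "(\<integral>\<^sup>+x. ennreal ((norm x)\<^sup>2) \<partial>(std_gaussian :: (real^'q) measure)) = ennreal m2"
    using second_moment_std_gaussian_finite[where 'q = 'q] by (simp add: m2_def)
  have m20: "m2 \<ge> 0" by (simp add: m2_def)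
  have "(h j)\<^sup>2 > 0" for j
    using assms(10) by (rule zero_less_power)
  then have \<rho>: "\<rho>0 > 0" "\<rho>0 \<le> (h j)\<^sup>2" for j
    unfolding \<rho>0_def by (subst Min_gr_iff, auto)
  have K: "K > 0" by (simp add: K_def)
  have a: "a \<ge> 0" unfolding a_def using K \<rho>(1) \<beta> by (intro mult_nonneg_nonneg) auto
  \<comment> \<open>Since \<open>a = 4 * K * L\<^sup>2 / (\<rho>0 * \<beta>)\<close>, the
    contribution of the observation is the fraction \<open>\<beta> * (1 + \<beta>) / 2\<close> of
    \<open>a\<close>.\<close>
  have a1_eq: "a1 = a * (1 + \<beta> * (1 + \<beta>) / 2)"
    using \<beta> \<rho>(1) by (simp add: a1_def a_def field_simps)
  have a1: "a1 \<ge> 0" using a \<beta> by (simp add: a1_eq)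
  have b: "b \<ge> 0" unfolding b_def using K \<rho>(1) \<beta> by (intro mult_nonneg_nonneg divide_nonneg_nonneg add_nonneg_nonneg) auto
  have d: "d \<ge> 0" unfolding d_def using K \<rho>(1) \<beta> by (intro mult_nonneg_nonneg add_nonneg_nonneg divide_nonneg_nonneg) auto
  have D: "D > 0"
  proof -
    have "(1 + \<beta> / 2) * (K * Kh) > 0" using \<beta> K Kh by (intro mult_pos_pos) auto
    moreover have "a1 * Kh \<ge> 0" "b * m2 \<ge> 0" using a1 b m20 Kh by auto
    ultimately show ?thesis unfolding D_def using d by linarith
  qed
  have E_eq: "E n \<omega> = a * (norm (U n \<omega>))\<^sup>2 + (\<Sum>k\<in>UNIV. (norm (V n k \<omega>))\<^sup>2)" for n \<omega>
    by (simp add: E_def a_def K_def L_def)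
  have E0: "E n \<omega> \<ge> 0" for n \<omega>
    unfolding E_eq using a by (intro add_nonneg_nonneg mult_nonneg_nonneg sum_nonneg) auto
  have EM [measurable]: "E n \<in> borel_measurable M" for n
    unfolding E_eq[abs_def] by measurable

  \<comment> \<open>Pathwise inequality for the energy\<close>
  have path: "AE \<omega> in M. E n \<omega> \<le> a1 * (norm (U n \<omega>))\<^sup>2
      + (1 + \<beta> / 2) * (\<Sum>k\<in>UNIV. (norm (Vf n k \<omega>))\<^sup>2) + (b * (norm (\<xi> n \<omega>))\<^sup>2 + d)"
    if n: "n \<ge> 1" for n
    using lam_ge[OF n] AE_space
  proof eventually_elim
    case (elim \<omega>)
    have "(\<Sum>k\<in>UNIV. (norm (V n k \<omega>))\<^sup>2) \<le> 2 * K / \<rho>0 * (norm (Z n \<omega>))\<^sup>2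
        + (1 + \<beta> / 2) * (\<Sum>k\<in>UNIV. (norm (Vf n k \<omega>))\<^sup>2) + d"
      unfolding V_eq[OF n elim(2)] K_def d_def L_def
      by (rule analysis_energy_le[OF inj H_def \<rho> c _ card elim(1) Vmean_eq[OF n elim(2)]
            S_cov[OF n elim(2)] S_sum[OF n elim(2)] D0_def]) (use \<beta> in simp)
    moreover have "(norm (Z n \<omega>))\<^sup>2 \<le> (1 + \<beta>) * (L\<^sup>2 * (norm (U n \<omega>))\<^sup>2) + (1 + 1 / \<beta>) * (norm (\<xi> n \<omega>))\<^sup>2"
    proof -
      have "(norm (H *v U n \<omega>))\<^sup>2 \<le> (L * norm (U n \<omega>))\<^sup>2"
        unfolding L_def by (intro power_mono norm_mult_le_opnorm) simp
      then have "(1 + \<beta>) * (norm (H *v U n \<omega>))\<^sup>2 \<le> (1 + \<beta>) * (L\<^sup>2 * (norm (U n \<omega>))\<^sup>2)"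
        using \<beta> by (intro mult_left_mono) (auto simp: power_mult_distrib)
      with norm_add_sq_le[OF \<beta>(1), of "H *v U n \<omega>" "\<xi> n \<omega>"] show ?thesis
        unfolding Z_eq[OF n elim(2)] by linarith
    qed
    then have "2 * K / \<rho>0 * (norm (Z n \<omega>))\<^sup>2
        \<le> 2 * K / \<rho>0 * ((1 + \<beta>) * (L\<^sup>2 * (norm (U n \<omega>))\<^sup>2) + (1 + 1 / \<beta>) * (norm (\<xi> n \<omega>))\<^sup>2)"
      using K \<rho>(1) by (intro mult_left_mono) auto
    moreover have "\<dots> = (a1 - a) * (norm (U n \<omega>))\<^sup>2 + b * (norm (\<xi> n \<omega>))\<^sup>2"
      by (simp add: a1_def b_def algebra_simps add_divide_distrib)
    ultimately show ?case unfolding E_eq by (simp add: algebra_simps)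
  qed

  \<comment> \<open>Contraction in conditional expectation\<close>
  have step: "AE \<omega> in M. nn_cond_exp M (F (n - 1)) (\<lambda>\<omega>. ennreal (E n \<omega>)) \<omega>
      \<le> ennreal ((1 - \<beta> / 2) * E (n - 1) \<omega> + D)" if n: "n \<ge> 1" for n
  proof -
    define m where "m = n - 1"
    interpret F: finite_measure_subalgebra M "F m" by unfold_locales (rule MF)
    note law = law[OF n, folded m_def]
    have [measurable]: "\<xi> n \<in> borel_measurable M" "\<zeta> n \<in> borel_measurable M"
        "\<zeta>e n k \<in> borel_measurable M" "Vf n k \<in> borel_measurable M" for k
      using \<xi>M \<zeta>M \<zeta>eM VfM n by auto
    define eU where "eU \<omega> = (norm (\<Psi> (U m \<omega>)))\<^sup>2 + trace (R (U m \<omega>))" for \<omega>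
    define eV where "eV k \<omega> = (norm (\<Psi> (V m k \<omega>)))\<^sup>2 + trace (R (V m k \<omega>))" for k \<omega>
    have pos: "eU \<omega> \<ge> 0" "eV k \<omega> \<ge> 0" for k \<omega>
      by (simp_all add: eU_def eV_def R_def trace_second_moment_nonneg)
    have cU: "AE \<omega> in M. nn_cond_exp M (F m) (\<lambda>\<omega>. ennreal ((norm (U n \<omega>))\<^sup>2)) \<omega> = ennreal (eU \<omega>)"
      unfolding eU_def R_def
      by (rule nn_cond_exp_norm_add_noise_sq[OF MG GF _ UVF(1) \<kappa> int mean \<Psi> cond_noise_law_signal[OF law k]])
         (use n in \<open>auto simp: U_eq m_def\<close>)
    have cV: "AE \<omega> in M. nn_cond_exp M (F m) (\<lambda>\<omega>. ennreal ((norm (Vf n k \<omega>))\<^sup>2)) \<omega> = ennreal (eV k \<omega>)" for k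
      unfolding eV_def R_def
      by (rule nn_cond_exp_norm_add_noise_sq[OF MG GF _ UVF(2) \<kappa> int mean \<Psi> cond_noise_law_ensemble[OF law k]])
         (use n in \<open>auto simp: Vf_eq m_def\<close>)
    have cX: "AE \<omega> in M. nn_cond_exp M (F m) (\<lambda>\<omega>. ennreal ((norm (\<xi> n \<omega>))\<^sup>2)) \<omega> = ennreal m2"
    proof -
      \<comment> \<open>The Gaussian law is treated as a constant kernel over the state space, with
        \<open>U m\<close> as the conditioning variable.\<close>
      have g: "(\<lambda>_. std_gaussian) \<in> (borel :: (real^'d) measure) \<rightarrow>\<^sub>M subprob_algebra (borel :: (real^'q) measure)"
        by (intro measurable_const)
           (simp add: space_subprob_algebra sets_std_gaussian prob_space_imp_subprob_space prob_space_std_gaussian)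
      have "AE \<omega> in M. (\<integral>\<^sup>+y. ennreal ((norm y)\<^sup>2) \<partial>(std_gaussian :: (real^'q) measure))
          = nn_cond_exp M (F m) (\<lambda>\<omega>. ennreal ((norm (\<xi> n \<omega>))\<^sup>2)) \<omega>"
        using cond_noise_law_observation[OF law k]
      proof (rule nn_cond_exp_kernel[OF MG GF \<xi>M[OF n] UVF(1) g, where f = "\<lambda>_ y. ennreal ((norm y)\<^sup>2)"])
        show "(\<lambda>(_, y). ennreal ((norm y)\<^sup>2)) \<in> borel_measurable ((borel :: (real^'d) measure) \<Otimes>\<^sub>M (borel :: (real^'q) measure))"
          by measurable
      qed
      then show ?thesis by eventually_elim (simp add: m2)
    qed
    have cVs: "AE \<omega> in M. nn_cond_exp M (F m) (\<lambda>\<omega>. \<Sum>k\<in>UNIV. ennreal ((norm (Vf n k \<omega>))\<^sup>2)) \<omega>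
        = (\<Sum>k\<in>UNIV. ennreal (eV k \<omega>))"
    proof -
      have "AE \<omega> in M. \<forall>k. nn_cond_exp M (F m) (\<lambda>\<omega>. ennreal ((norm (Vf n k \<omega>))\<^sup>2)) \<omega> = ennreal (eV k \<omega>)"
        using cV by (simp add: AE_all_countable)
      moreover have "AE \<omega> in M. nn_cond_exp M (F m) (\<lambda>\<omega>. \<Sum>k\<in>UNIV. ennreal ((norm (Vf n k \<omega>))\<^sup>2)) \<omega>
          = (\<Sum>k\<in>UNIV. nn_cond_exp M (F m) (\<lambda>\<omega>. ennreal ((norm (Vf n k \<omega>))\<^sup>2)) \<omega>)"
        by (rule F.nn_cond_exp_finite_sum) auto
      ultimately show ?thesis by eventually_elim simp
    qed
    let ?f = "\<lambda>\<omega>. ennreal a1 * ennreal ((norm (U n \<omega>))\<^sup>2)"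
    let ?g = "\<lambda>\<omega>. ennreal (1 + \<beta> / 2) * (\<Sum>k\<in>UNIV. ennreal ((norm (Vf n k \<omega>))\<^sup>2))"
    let ?x = "\<lambda>\<omega>. ennreal b * ennreal ((norm (\<xi> n \<omega>))\<^sup>2)"
    \<comment> \<open>The computation stays in \<open>ennreal\<close>, so the energies may have
      infinite expectation here.\<close>
    have "AE \<omega> in M. nn_cond_exp M (F m) (\<lambda>\<omega>. ennreal (E n \<omega>)) \<omega>
        \<le> nn_cond_exp M (F m) (\<lambda>\<omega>. (?f \<omega> + ?g \<omega>) + (?x \<omega> + ennreal d)) \<omega>"
    proof (rule F.nn_cond_exp_mono)
      show "AE \<omega> in M. ennreal (E n \<omega>) \<le> (?f \<omega> + ?g \<omega>) + (?x \<omega> + ennreal d)"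
        using path[OF n]
      proof eventually_elim
        case (elim \<omega>)
        have "(?f \<omega> + ?g \<omega>) + (?x \<omega> + ennreal d) = ennreal (a1 * (norm (U n \<omega>))\<^sup>2
            + (1 + \<beta> / 2) * (\<Sum>k\<in>UNIV. (norm (Vf n k \<omega>))\<^sup>2) + (b * (norm (\<xi> n \<omega>))\<^sup>2 + d))"
          using a1 b d \<beta> by (simp add: ennreal_mult sum_nonneg)
        with elim show ?case by (simp add: ennreal_leI)
      qed
    qed measurable
    moreover have "AE \<omega> in M. nn_cond_exp M (F m) (\<lambda>\<omega>. (?f \<omega> + ?g \<omega>) + (?x \<omega> + ennreal d)) \<omega>
        = nn_cond_exp M (F m) (\<lambda>\<omega>. ?f \<omega> + ?g \<omega>) \<omega> + nn_cond_exp M (F m) (\<lambda>\<omega>. ?x \<omega> + ennreal d) \<omega>"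
      by (rule F.nn_cond_exp_add) measurable
    moreover have "AE \<omega> in M. nn_cond_exp M (F m) (\<lambda>\<omega>. ?f \<omega> + ?g \<omega>) \<omega>
        = nn_cond_exp M (F m) ?f \<omega> + nn_cond_exp M (F m) ?g \<omega>"
      by (rule F.nn_cond_exp_add) measurable
    moreover have "AE \<omega> in M. nn_cond_exp M (F m) (\<lambda>\<omega>. ?x \<omega> + ennreal d) \<omega>
        = nn_cond_exp M (F m) ?x \<omega> + nn_cond_exp M (F m) (\<lambda>_. ennreal d) \<omega>"
      by (rule F.nn_cond_exp_add) measurable
    moreover have "AE \<omega> in M. ennreal d = nn_cond_exp M (F m) (\<lambda>_. ennreal d) \<omega>"
      by (rule F.nn_cond_exp_F_meas) measurable
    moreover have "AE \<omega> in M. nn_cond_exp M (F m) ?f \<omega>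
        = ennreal a1 * nn_cond_exp M (F m) (\<lambda>\<omega>. ennreal ((norm (U n \<omega>))\<^sup>2)) \<omega>"
      by (rule F.nn_cond_exp_cmult) measurable
    moreover have "AE \<omega> in M. nn_cond_exp M (F m) ?g \<omega> = ennreal (1 + \<beta> / 2)
        * nn_cond_exp M (F m) (\<lambda>\<omega>. \<Sum>k\<in>UNIV. ennreal ((norm (Vf n k \<omega>))\<^sup>2)) \<omega>"
      by (rule F.nn_cond_exp_cmult) measurable
    moreover have "AE \<omega> in M. nn_cond_exp M (F m) ?x \<omega>
        = ennreal b * nn_cond_exp M (F m) (\<lambda>\<omega>. ennreal ((norm (\<xi> n \<omega>))\<^sup>2)) \<omega>"
      by (rule F.nn_cond_exp_cmult) measurable
    ultimately have "AE \<omega> in M. nn_cond_exp M (F m) (\<lambda>\<omega>. ennreal (E n \<omega>)) \<omega>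
        \<le> ennreal ((1 - \<beta> / 2) * E m \<omega> + D)"
      using cU cVs cX
    proof eventually_elim
      case (elim \<omega>)
      have "nn_cond_exp M (F m) (\<lambda>\<omega>. ennreal (E n \<omega>)) \<omega>
          \<le> (ennreal a1 * ennreal (eU \<omega>) + ennreal (1 + \<beta> / 2) * (\<Sum>k\<in>UNIV. ennreal (eV k \<omega>)))
            + (ennreal b * ennreal m2 + ennreal d)"
        using elim by simp
      also have "\<dots> = ennreal (a1 * eU \<omega> + (1 + \<beta> / 2) * (\<Sum>k\<in>UNIV. eV k \<omega>) + (b * m2 + d))"
        using a1 b d \<beta> pos m20 by (simp add: ennreal_mult sum_nonneg)
      also have "\<dots> \<le> ennreal ((1 - \<beta> / 2) * E m \<omega> + D)"
      proof (rule ennreal_leI)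
        have "a1 * eU \<omega> \<le> a1 * ((1 - \<beta>) * (norm (U m \<omega>))\<^sup>2 + Kh)"
          unfolding eU_def by (intro mult_left_mono energy a1)
        \<comment> \<open>Here the signal weight in the energy pays for the observation: the growth
          factor of \<open>a1_eq\<close> is absorbed by half of the dissipation.\<close>
        also have "a1 * (1 - \<beta>) \<le> a * (1 - \<beta> / 2)"
        proof -
          have "(1 + \<beta> * (1 + \<beta>) / 2) * (1 - \<beta>) = 1 - \<beta> / 2 - \<beta> ^ 3 / 2"
            by (simp add: field_simps power3_eq_cube)
          also have "\<dots> \<le> 1 - \<beta> / 2" using \<beta> by simp
          finally show ?thesis
            unfolding a1_eq mult.assoc using a by (rule mult_left_mono)
        qed
        then have "a1 * ((1 - \<beta>) * (norm (U m \<omega>))\<^sup>2 + Kh) \<le> (1 - \<beta> / 2) * (a * (norm (U m \<omega>))\<^sup>2) + a1 * Kh"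
          using mult_right_mono[of "a1 * (1 - \<beta>)" "a * (1 - \<beta> / 2)" "(norm (U m \<omega>))\<^sup>2"]
          by (simp add: algebra_simps)
        finally have U: "a1 * eU \<omega> \<le> (1 - \<beta> / 2) * (a * (norm (U m \<omega>))\<^sup>2) + a1 * Kh" .
        define s where "s = (\<Sum>k\<in>UNIV. (norm (V m k \<omega>))\<^sup>2)"
        have s0: "s \<ge> 0" unfolding s_def by (simp add: sum_nonneg)
        have "(\<Sum>k\<in>UNIV. eV k \<omega>) \<le> (\<Sum>k\<in>UNIV. (1 - \<beta>) * (norm (V m k \<omega>))\<^sup>2 + Kh)"
          unfolding eV_def by (intro sum_mono energy)
        also have "\<dots> = (1 - \<beta>) * s + K * Kh"
          by (simp add: sum.distrib sum_distrib_left K_def s_def)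
        finally have "(1 + \<beta> / 2) * (\<Sum>k\<in>UNIV. eV k \<omega>) \<le> (1 + \<beta> / 2) * ((1 - \<beta>) * s + K * Kh)"
          using \<beta> by (intro mult_left_mono) auto
        \<comment> \<open>The choice \<open>e = \<beta> / 2\<close> leaves half of the dissipation,
          with the nonpositive surplus \<open>- \<beta>\<^sup>2 / 2 * s\<close>.\<close>
        also have "\<dots> = (1 - \<beta> / 2) * s - \<beta>\<^sup>2 / 2 * s + (1 + \<beta> / 2) * (K * Kh)"
          by (simp add: algebra_simps power2_eq_square)
        also have "\<dots> \<le> (1 - \<beta> / 2) * s + (1 + \<beta> / 2) * (K * Kh)"
          using s0 by simp
        finally show "a1 * eU \<omega> + (1 + \<beta> / 2) * (\<Sum>k\<in>UNIV. eV k \<omega>) + (b * m2 + d) \<le> (1 - \<beta> / 2) * E m \<omega> + D"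
          using U unfolding E_eq D_def s_def[symmetric] by (simp add: algebra_simps)
      qed
      finally show ?case .
    qed
    then show ?thesis by (simp add: m_def)
  qed

  \<comment> \<open>Uniform bound on the expected energy, by integrating the conditional estimate
    and iterating\<close>
  have "(\<integral>\<^sup>+\<omega>. ennreal (E (Suc n) \<omega>) \<partial>M)
      \<le> ennreal (1 - \<beta> / 2) * (\<integral>\<^sup>+\<omega>. ennreal (E n \<omega>) \<partial>M) + ennreal D" for n
  proof -
    interpret F: finite_measure_subalgebra M "F n" by unfold_locales (rule MF)
    have "(\<integral>\<^sup>+\<omega>. ennreal (E (Suc n) \<omega>) \<partial>M) = (\<integral>\<^sup>+\<omega>. nn_cond_exp M (F n) (\<lambda>\<omega>. ennreal (E (Suc n) \<omega>)) \<omega> \<partial>M)"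
      using F.nn_cond_exp_intg[of "\<lambda>_. 1" "\<lambda>\<omega>. ennreal (E (Suc n) \<omega>)"] by simp
    also have "\<dots> \<le> (\<integral>\<^sup>+\<omega>. ennreal ((1 - \<beta> / 2) * E n \<omega> + D) \<partial>M)"
      using step[of "Suc n"] by (intro nn_integral_mono_AE) simp
    also have "\<dots> = (\<integral>\<^sup>+\<omega>. ennreal (1 - \<beta> / 2) * ennreal (E n \<omega>) + ennreal D \<partial>M)"
      using \<beta> D E0 by (intro nn_integral_cong) (simp add: ennreal_mult)
    also have "\<dots> = ennreal (1 - \<beta> / 2) * (\<integral>\<^sup>+\<omega>. ennreal (E n \<omega>) \<partial>M) + ennreal D"
      by (simp add: nn_integral_add nn_integral_cmult emeasure_space_1)
    finally show ?thesis .
  qed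
  then have "(\<integral>\<^sup>+\<omega>. ennreal (E 0 \<omega>) \<partial>M) < \<infinity> \<Longrightarrow> (SUP n. \<integral>\<^sup>+\<omega>. ennreal (E n \<omega>) \<partial>M) < \<infinity>"
    by (rule ennreal_affine_recursion_bounded[where q = "1 - \<beta> / 2"]) (use \<beta> D in auto)
  with step D show ?thesis by blast
qed

end
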